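(* Let $\boldsymbol{\pi}$ be the closed-loop RNN system described in the context, let $\mathcal{X}\subset\mathbb{R}^n$ be a hybrid zonotope (HZ), $T>1$, and let $\{\tilde{\mathcal{S}}^{N_b}_{x,t}\}_{t=2}^T$ be the over-approximations of the state-pair sets over the domain $\mathcal{X}$ computed by the relaxed algorithm described in the context with binary limit parameter $N_b\in\mathbb{Z}_{\ge0}$. Then for every $t\in\{2,\dots,T\}$: (i) Given an initial set $\mathcal{X}_1\subseteq\mathcal{X}$ (represented as an HZ), an over-approximated forward reachable set can be computed by $$\tilde{\mathcal{R}}_t(\mathcal{X}_1)=[\mathbf{0}_{n\times n}\;\;\boldsymbol{I}_n]\cdot\big(\tilde{\mathcal{S}}^{N_b}_{x,t}\cap_{[\boldsymbol{I}_n\;\mathbf{0}_{n\times n}]}\mathcal{X}_1\big)\supseteq\mathcal{R}_t(\mathcal{X}_1).$$ (ii) Given a target set $\mathcal{T}\subseteq\mathcal{X}$ (represented as an HZ), an over-approximated backward reachable set can be computed by $$\tilde{\mathcal{P}}_t(\mathcal{T})=[\boldsymbol{I}_n\;\;\mathbf{0}_{n\times n}]\cdot\big(\tilde{\mathcal{S}}^{N_b}_{x,t}\cap_{[\mathbf{0}_{n\times n}\;\boldsymbol{I}_n]}\mathcal{T}\big)\supseteq\mathcal{P}_t(\mathcal{T}).$$ (iii) The over-approximations in (i) and (ii) become exact (i.e. the inclusions are equalities) when $N_b\ge N_t$, where $N_t$ is the total number of unstable ReLU activations at step $t$. (iv) The sizes of $\tilde{\mathcal{R}}_t(\mathcal{X}_1)$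 and $\tilde{\mathcal{P}}_t(\mathcal{T})$ decrease monotonically with $N_b$; that is, if $0\le N_b\le N_b'$, then the sets obtained with parameter $N_b$ contain the corresponding sets obtained with parameter $N_b'$.
   Context: **Hybrid zonotopes.** A set $\mathcal{Z}\subset\mathbb{R}^n$ is a hybrid zonotope (HZ) if there are $\mathbf{c}\in\mathbb{R}^n$, $\mathbf{G}^c\in\mathbb{R}^{n\times n_g}$, $\mathbf{G}^b\in\mathbb{R}^{n\times n_b}$, $\mathbf{A}^c\in\mathbb{R}^{n_c\times n_g}$, $\mathbf{A}^b\in\mathbb{R}^{n_c\times n_b}$, $\mathbf{b}\in\mathbb{R}^{n_c}$ with $\mathcal{Z}=\{\mathbf{G}^c\xi^c+\mathbf{G}^b\xi^b+\mathbf{c}\mid \|\xi^c\|_\infty\le1,\ \xi^b\in\{-1,1\}^{n_b},\ \mathbf{A}^c\xi^c+\mathbf{A}^b\xi^b=\mathbf{b}\}$; write $\mathcal{Z}=\langle\mathbf{G}^c,\mathbf{G}^b,\mathbf{c},\mathbf{A}^c,\mathbf{A}^b,\mathbf{b}\rangle$ (numbers of generators or constraints may be $0$). The algorithm operates on such representations. Operations: - Affine map: $R\mathcal{Z}+v=\langle R\mathbf{G}^c,R\mathbf{G}^b,R\mathbf{c}+v,\mathbf{A}^c,\mathbf{A}^b,\mathbf{b}\rangle$. Cartesian products use block-diagonal matrices. - Generalized intersection: $\mathcal{Z}\cap_R\mathcal{Y}=\{z\in\mathcal{Z}\mid Rz\in\mathcal{Y}\}$, represented by $$\left\langle[\mathbf{0}\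 \mathbf{G}_z^c],[\mathbf{0}\ \mathbf{G}_z^b],\mathbf{c}_z,\begin{bmatrix}\mathbf{A}_y^c&\mathbf{0}\\\mathbf{0}&\mathbf{A}_z^c\\-\mathbf{G}_y^c&R\mathbf{G}_z^c\end{bmatrix},\begin{bmatrix}\mathbf{A}_y^b&\mathbf{0}\\\mathbf{0}&\mathbf{A}_z^b\\-\mathbf{G}_y^b&R\mathbf{G}_z^b\end{bmatrix},\begin{bmatrix}\mathbf{b}_y\\\mathbf{b}_z\\\mathbf{c}_y-R\mathbf{c}_z\end{bmatrix}\right\rangle.$$ - Constrained product: if $\mathbf{A}^c_y=\begin{bmatrix}\mathbf{A}^c_z\ \ \mathbf{0}\\\bar{\mathbf{A}}^c_y\end{bmatrix}$, $\mathbf{A}^b_y=\begin{bmatrix}\mathbf{A}^b_z\ \ \mathbf{0}\\\bar{\mathbf{A}}^b_y\end{bmatrix}$, $\mathbf{b}_y=\begin{bmatrix}\mathbf{b}_z\\\bar{\mathbf{b}}_y\end{bmatrix}$ (top block rows $[\mathbf{A}_z\ \mathbf{0}]$), then $$\mathcal{C}(\mathcal{Z},\mathcal{Y})=\left\langle\begin{bmatrix}\mathbf{G}^c_z\ \ \mathbf{0}\\\mathbf{G}^c_y\end{bmatrix},\begin{bmatrix}\mathbf{G}^b_z\ \ \mathbf{0}\\\mathbf{G}^b_y\end{bmatrix},\begin{bmatrix}\mathbf{c}_z\\\mathbf{c}_y\end{bmatrix},\mathbf{A}^c_y,\mathbf{A}^b_y,\mathbf{b}_y\right\rangle.$$ **Closed-loop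 RNN.** $\boldsymbol{\pi}$ has $L$ hidden layers with weights $W_h^{(\ell)}\in\mathbb{R}^{n_\ell\times n_\ell}$, $W_x^{(\ell)}\in\mathbb{R}^{n_\ell\times n_{\ell-1}}$, $v_h^{(\ell)}\in\mathbb{R}^{n_\ell}$ ($\ell\in[L]=\{1,\dots,L\}$, $n_0=n$), output weights $W_y\in\mathbb{R}^{n\times n_L}$, $v_y\in\mathbb{R}^n$, and $\sigma$ the componentwise ReLU. From $x_1\in\mathcal{X}$ and zero initial hidden states $h_0^{(\ell)}=0$: $h_t^{(0)}=x_t$, $h_t^{(\ell)}=\sigma(W_h^{(\ell)}h_{t-1}^{(\ell)}+W_x^{(\ell)}h_t^{(\ell-1)}+v_h^{(\ell)})$ for $\ell\in[L]$, and $x_{t+1}=\sigma(W_yh_t^{(L)}+v_y)$. This is abbreviated $x_{t+1}=\boldsymbol{\pi}(x_t)$ (hidden states are carried along); $\mathcal{X}$ is the state domain. **Exact sets.** State-pair set: $\mathcal{S}_x(\mathcal{X},t)=\{(x_1,x_t)\mid x_1\in\mathcal{X},\ x_{k+1}=\boldsymbol{\pi}(x_k),\ k\in[t-1]\}$. Forward/backward reachable sets: $\mathcal{R}_t(\mathcal{X}_1)=\{x_t\mid x_1\in\mathcal{X}_1,\ x_{k+1}=\boldsymbol{\pi}(x_k),\ k\in[t-1]\}$, $\mathcal{P}_t(\mathcal{T})=\{x_1\in\mathcal{X}\mid x_t\in\mathcal{T},\ x_{k+1}=\boldsymbol{\pi}(x_k),\ k\in[t-1]\}$. **ReLU graph and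 relaxation.** For an interval $[\alpha,\beta]$, $\mathcal{G}_{ReLU}([\alpha,\beta])$ denotes an HZ exactly representing $\{(s,\max(s,0))\mid s\in[\alpha,\beta]\}$: a segment with one continuous generator if $\alpha\ge0$ or $\beta\le0$ (a stable unit), and a fixed HZ $\mathcal{H}_\pm=\langle\mathbf{G}^c_\pm,\mathbf{G}^b_\pm,\mathbf{c}_\pm,\mathbf{A}^c_\pm,\mathbf{A}^b_\pm,\mathbf{b}_\pm\rangle$ with one binary generator if $\alpha<0<\beta$ (an unstable unit). The triangle relaxation is $\mathcal{H}_\triangle=\langle[\mathbf{G}^c_\pm\ \mathbf{G}^b_\pm],\emptyset,\mathbf{c}_\pm,[\mathbf{A}^c_\pm\ \mathbf{A}^b_\pm],\emptyset,\mathbf{b}_\pm\rangle\supset\mathcal{H}_\pm$, which equals the convex hull of the graph (a triangle of area $-\alpha\beta/2$). For a label in $\{0,1\}$, $\tilde{\mathcal{G}}_{ReLU}([\alpha,\beta],\text{label})=\mathcal{H}_\triangle$ if $\alpha<0<\beta$ and label $=1$, and $=\mathcal{G}_{ReLU}([\alpha,\beta])$ otherwise. For boxes with label vectors, take Cartesian products over coordinates; $P$ is the permutation matrix listing all input coordinates first, then all output coordinates. **Relaxed algorithm.** Input: HZ $\mathcal{X}$, the RNN, $T>1$, $N_b\in\mathbb{Z}_{\ge0}$. First compute (independently of $N_b$) sound boxes $\mathcal{I}_{h,t}^{(\ell)}$, $\mathcal{I}_{y,t}$ ($t\in[T-1]$, $\ell\in[L]$) containing, for every $x_1\in\mathcal{X}$,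 the pre-activations $W_h^{(\ell)}h_{t-1}^{(\ell)}+W_x^{(\ell)}h_t^{(\ell-1)}+v_h^{(\ell)}$ and $W_yh_t^{(L)}+v_y$ respectively. Rank all unstable ReLU units across all layers and all time steps $t\in[T-1]$ in descending order of the score $-\alpha\beta/2$ ($[\alpha,\beta]$ the unit's input interval; ties broken by a fixed rule independent of $N_b$); give label $0$ to the top $N_b$ units and label $1$ to the remaining unstable ones. Set $\tilde{\mathcal{H}}_1^{(0)}=\mathcal{X}$. For $t=1,\dots,T-1$: for $\ell=1,\dots,L$: let $\tilde{\mathcal{Z}}=W_x^{(\ell)}\tilde{\mathcal{H}}_1^{(\ell-1)}+v_h^{(\ell)}$ if $t=1$, and $\tilde{\mathcal{Z}}=[W_h^{(\ell)}\ W_x^{(\ell)}]\,\mathcal{C}(\tilde{\mathcal{H}}_{t-1}^{(\ell)},\tilde{\mathcal{H}}_t^{(\ell-1)})+v_h^{(\ell)}$ if $t\ge2$; set $\tilde{\mathcal{H}}_t^{(\ell)}=[\mathbf{0}\ \boldsymbol{I}]\big((P\,\tilde{\mathcal{G}}_{ReLU}(\mathcal{I}_{h,t}^{(\ell)},\text{label}_{h,t}^{(\ell)}))\cap_{[\boldsymbol{I}\ \mathbf{0}]}\tilde{\mathcal{Z}}\big)$. Then with $\tilde{\mathcal{Z}}_y=W_y\tilde{\mathcal{H}}_t^{(L)}+v_y$ set $\tilde{\mathcal{H}}_{t+1}^{(0)}=[\mathbf{0}\ \boldsymbol{I}]\big((P\,\tilde{\mathcal{G}}_{ReLU}(\mathcal{I}_{y,t},\text{label}_{y,t}))\cap_{[\boldsymbol{I}\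 \mathbf{0}]}\tilde{\mathcal{Z}}_y\big)$ and $\tilde{\mathcal{S}}_{x,t+1}^{N_b}=\mathcal{C}(\tilde{\mathcal{H}}_1^{(0)},\tilde{\mathcal{H}}_{t+1}^{(0)})$. Output: $\{\tilde{\mathcal{S}}_{x,t}^{N_b}\}_{t=2}^T$. **$N_t$.** $N_t$ is the total number of unstable ReLU activations (input interval with $\alpha<0<\beta$) in the RNN at step $t$, counted cumulatively over all units evaluated in computing $x_t$ from $x_1$ (time steps $1,\dots,t-1$, all hidden layers and the output layer).
   Formalization: In (iii) exactness is stated for N_b ≥ N_t plus the number of unstable units at steps ≥ t ranked ahead of some unstable unit at a step < t (zero when t = T); with N_b ≥ N_t alone the claim is false for t < T, since later units can use up the budget. *)

theory Defs
  imports "HOL-Analysis.Convex" "Jordan_Normal_Form.Matrix"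
begin

definition append_cols :: "'a :: zero mat \<Rightarrow> 'a mat \<Rightarrow> 'a mat" where
  "append_cols A B = four_block_mat A B (0\<^sub>m 0 (dim_col A)) (0\<^sub>m 0 (dim_col B))"


section \<open>Hybrid zonotopes\<close>

text \<open>
  Operations act on representations; \<open>hz_set\<close> is the represented set. The numbers of generators and
  of constraints are the matrix dimensions and may be zero.
\<close>

record hz =
  Gc :: "real mat"
  Gb :: "real mat"
  ctr :: "real vec"
  Ac :: "real mat"
  Ab :: "real mat"
  rhs :: "real vec"

definition hz_wf :: "nat \<Rightarrow> hz \<Rightarrow> bool" where
  "hz_wf n Z \<longleftrightarrow>
     ctr Z \<in> carrier_vec n \<and>
     Gc Z \<in> carrier_mat n (dim_col (Gc Z)) \<and>
     Gb Z \<in> carrier_mat n (dim_col (Gb Z)) \<and>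
     Ac Z \<in> carrier_mat (dim_vec (rhs Z)) (dim_col (Gc Z)) \<and>
     Ab Z \<in> carrier_mat (dim_vec (rhs Z)) (dim_col (Gb Z))"

definition hz_set :: "hz \<Rightarrow> real vec set" where
  "hz_set Z = {Gc Z *\<^sub>v x + Gb Z *\<^sub>v y + ctr Z | x y.
     x \<in> carrier_vec (dim_col (Gc Z)) \<and> (\<forall>i<dim_col (Gc Z). \<bar>x $ i\<bar> \<le> 1) \<and>
     y \<in> carrier_vec (dim_col (Gb Z)) \<and> (\<forall>i<dim_col (Gb Z). y $ i \<in> {-1, 1}) \<and>
     Ac Z *\<^sub>v x + Ab Z *\<^sub>v y = rhs Z}"

definition hz_affine :: "real mat \<Rightarrow> real vec \<Rightarrow> hz \<Rightarrow> hz" where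
  "hz_affine R v Z =
     \<lparr>Gc = R * Gc Z, Gb = R * Gb Z, ctr = R *\<^sub>v ctr Z + v, Ac = Ac Z, Ab = Ab Z, rhs = rhs Z\<rparr>"

definition hz_linear :: "real mat \<Rightarrow> hz \<Rightarrow> hz" where
  "hz_linear R Z = hz_affine R (0\<^sub>v (dim_row R)) Z"

definition block_diag :: "real mat \<Rightarrow> real mat \<Rightarrow> real mat" where
  "block_diag A B =
     four_block_mat A (0\<^sub>m (dim_row A) (dim_col B)) (0\<^sub>m (dim_row B) (dim_col A)) B"

definition hz_cart :: "hz \<Rightarrow> hz \<Rightarrow> hz" where
  "hz_cart Z Y =
     \<lparr>Gc = block_diag (Gc Z) (Gc Y), Gb = block_diag (Gb Z) (Gb Y), ctr = ctr Z @\<^sub>v ctr Y,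
      Ac = block_diag (Ac Z) (Ac Y), Ab = block_diag (Ab Z) (Ab Y), rhs = rhs Z @\<^sub>v rhs Y\<rparr>"

definition hz_unit :: hz where
  "hz_unit = \<lparr>Gc = 0\<^sub>m 0 0, Gb = 0\<^sub>m 0 0, ctr = 0\<^sub>v 0, Ac = 0\<^sub>m 0 0, Ab = 0\<^sub>m 0 0, rhs = 0\<^sub>v 0\<rparr>"

text \<open>Generalized intersection: represents the set of all \<open>z\<close> in \<open>Z\<close> with \<open>R z\<close> in \<open>Y\<close>.\<close>

definition hz_inter :: "real mat \<Rightarrow> hz \<Rightarrow> hz \<Rightarrow> hz" where
  "hz_inter R Z Y =
     \<lparr>Gc = append_cols (0\<^sub>m (dim_row (Gc Z)) (dim_col (Gc Y))) (Gc Z),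
      Gb = append_cols (0\<^sub>m (dim_row (Gb Z)) (dim_col (Gb Y))) (Gb Z),
      ctr = ctr Z,
      Ac = block_diag (Ac Y) (Ac Z) @\<^sub>r append_cols (- Gc Y) (R * Gc Z),
      Ab = block_diag (Ab Y) (Ab Z) @\<^sub>r append_cols (- Gb Y) (R * Gb Z),
      rhs = rhs Y @\<^sub>v rhs Z @\<^sub>v (ctr Y - R *\<^sub>v ctr Z)\<rparr>"

text \<open>
  Constrained product: both arguments are driven by the same factors. It is meaningful when the
  constraints of \<open>Z\<close>, padded by zero columns, are the first constraints of \<open>Y\<close>. This is the case
  wherever it is used below, because \<open>hz_inter\<close> puts the constraints of its last argument first.
\<close>

definition hz_cprod :: "hz \<Rightarrow> hz \<Rightarrow> hz" where
  "hz_cprod Z Y =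
     \<lparr>Gc = append_cols (Gc Z) (0\<^sub>m (dim_row (Gc Z)) (dim_col (Gc Y) - dim_col (Gc Z))) @\<^sub>r Gc Y,
      Gb = append_cols (Gb Z) (0\<^sub>m (dim_row (Gb Z)) (dim_col (Gb Y) - dim_col (Gb Z))) @\<^sub>r Gb Y,
      ctr = ctr Z @\<^sub>v ctr Y,
      Ac = Ac Y, Ab = Ab Y, rhs = rhs Y\<rparr>"

text \<open>All binary generators become continuous ones.\<close>

definition hz_relax :: "hz \<Rightarrow> hz" where
  "hz_relax Z =
     \<lparr>Gc = append_cols (Gc Z) (Gb Z), Gb = 0\<^sub>m (dim_row (Gb Z)) 0, ctr = ctr Z,
      Ac = append_cols (Ac Z) (Ab Z), Ab = 0\<^sub>m (dim_row (Ab Z)) 0, rhs = rhs Z\<rparr>"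


section \<open>The closed-loop recurrent network\<close>

text \<open>Hidden layers are numbered \<open>1, \<dots>, depth\<close>, and \<open>width 0\<close> is the state dimension.\<close>

record rnn =
  depth :: nat
  width :: "nat \<Rightarrow> nat"
  Wh :: "nat \<Rightarrow> real mat"
  Wx :: "nat \<Rightarrow> real mat"
  vh :: "nat \<Rightarrow> real vec"
  Wy :: "real mat"
  vy :: "real vec"

definition rnn_wf :: "nat \<Rightarrow> rnn \<Rightarrow> bool" where
  "rnn_wf n \<pi> \<longleftrightarrow>
     width \<pi> 0 = n \<and>
     (\<forall>l\<in>{1..depth \<pi>}.
        Wh \<pi> l \<in> carrier_mat (width \<pi> l) (width \<pi> l) \<and>
        Wx \<pi> l \<in> carrier_mat (width \<pi> l) (width \<pi> (l - 1)) \<and>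
        vh \<pi> l \<in> carrier_vec (width \<pi> l)) \<and>
     Wy \<pi> \<in> carrier_mat n (width \<pi> (depth \<pi>)) \<and>
     vy \<pi> \<in> carrier_vec n"

definition relu_vec :: "real vec \<Rightarrow> real vec" where
  "relu_vec = map_vec (\<lambda>s. max s 0)"

text \<open>
  \<open>hid \<pi> x t l\<close> is the state of layer \<open>l\<close> at time \<open>t\<close> on the trajectory with \<open>x\<^sub>1 = x\<close>. Layer
  \<open>0\<close> carries the closed-loop state, so \<open>hid \<pi> x t 0\<close> is \<open>x\<^sub>t\<close> for \<open>t \<ge> 1\<close>.
\<close>

fun hid :: "rnn \<Rightarrow> real vec \<Rightarrow> nat \<Rightarrow> nat \<Rightarrow> real vec" where
  "hid \<pi> x 0 l = 0\<^sub>v (width \<pi> l)"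
| "hid \<pi> x (Suc 0) 0 = x"
| "hid \<pi> x (Suc (Suc t)) 0 = relu_vec (Wy \<pi> *\<^sub>v hid \<pi> x (Suc t) (depth \<pi>) + vy \<pi>)"
| "hid \<pi> x (Suc t) (Suc l) =
     relu_vec (Wh \<pi> (Suc l) *\<^sub>v hid \<pi> x t (Suc l) + Wx \<pi> (Suc l) *\<^sub>v hid \<pi> x (Suc t) l + vh \<pi> (Suc l))"

definition fwd_reach :: "rnn \<Rightarrow> nat \<Rightarrow> real vec set \<Rightarrow> real vec set" where
  "fwd_reach \<pi> t X1 = {hid \<pi> x t 0 | x. x \<in> X1}"

definition bwd_reach :: "rnn \<Rightarrow> real vec set \<Rightarrow> nat \<Rightarrow> real vec set \<Rightarrow> real vec set" where
  "bwd_reach \<pi> X t Tgt = {x \<in> X. hid \<pi> x t 0 \<in> Tgt}"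


section \<open>ReLU units, their input intervals, and the binary budget\<close>

text \<open>\<open>Hid t l i\<close> is unit \<open>i\<close> of hidden layer \<open>l\<close> at time \<open>t\<close>; \<open>Out t i\<close> belongs to the output layer.\<close>

datatype relu_unit = Hid (time: nat) nat nat | Out (time: nat) nat

fun preact :: "rnn \<Rightarrow> real vec \<Rightarrow> relu_unit \<Rightarrow> real" where
  "preact \<pi> x (Hid t l i) =
     (Wh \<pi> l *\<^sub>v hid \<pi> x (t - 1) l + Wx \<pi> l *\<^sub>v hid \<pi> x t (l - 1) + vh \<pi> l) $ i"
| "preact \<pi> x (Out t i) = (Wy \<pi> *\<^sub>v hid \<pi> x t (depth \<pi>) + vy \<pi>) $ i"

text \<open>The units evaluated in computing \<open>x\<^sub>t\<close> from \<open>x\<^sub>1\<close>.\<close>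

definition relu_units :: "rnn \<Rightarrow> nat \<Rightarrow> relu_unit set" where
  "relu_units \<pi> t =
     {Hid s l i | s l i. s \<in> {1..<t} \<and> l \<in> {1..depth \<pi>} \<and> i < width \<pi> l} \<union>
     {Out s i | s i. s \<in> {1..<t} \<and> i < width \<pi> 0}"

type_synonym boxes = "relu_unit \<Rightarrow> real \<times> real"

definition sound_boxes :: "rnn \<Rightarrow> real vec set \<Rightarrow> nat \<Rightarrow> boxes \<Rightarrow> bool" where
  "sound_boxes \<pi> X T I \<longleftrightarrow>
     (\<forall>u\<in>relu_units \<pi> T. fst (I u) \<le> snd (I u) \<and>
        (\<forall>x\<in>X. preact \<pi> x u \<in> {fst (I u)..snd (I u)}))"

definition unstable :: "boxes \<Rightarrow> relu_unit \<Rightarrow> bool" where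
  "unstable I u \<longleftrightarrow> fst (I u) < 0 \<and> 0 < snd (I u)"

definition score :: "boxes \<Rightarrow> relu_unit \<Rightarrow> real" where
  "score I u = - (fst (I u) * snd (I u)) / 2"

definition num_unstable :: "rnn \<Rightarrow> boxes \<Rightarrow> nat \<Rightarrow> nat" where
  "num_unstable \<pi> I t = card {u \<in> relu_units \<pi> t. unstable I u}"

text \<open>
  A ranking lists the unstable units by descending score; the order in which it lists units of equal
  score is the tie-breaking rule. The first \<open>N\<close> units of the list are encoded exactly.
\<close>

definition is_ranking :: "rnn \<Rightarrow> nat \<Rightarrow> boxes \<Rightarrow> relu_unit list \<Rightarrow> bool" where
  "is_ranking \<pi> T I us \<longleftrightarrow>
     distinct us \<and> set us = {u \<in> relu_units \<pi> T. unstable I u} \<and>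
     sorted_wrt (\<lambda>u v. score I u \<ge> score I v) us"

definition label :: "relu_unit list \<Rightarrow> nat \<Rightarrow> relu_unit \<Rightarrow> nat" where
  "label us N u = (if u \<in> set (drop N us) then 1 else 0)"

text \<open>
  Since one ranking covers all time steps up to the horizon, units that are not needed for \<open>x\<^sub>t\<close> can
  use up the budget before some unit that is, so a budget of \<open>num_unstable \<pi> I t\<close> alone does not
  guarantee exactness at time \<open>t\<close> unless \<open>t\<close> is the horizon. \<open>num_outranking\<close> counts such units.
\<close>

definition num_outranking :: "relu_unit list \<Rightarrow> nat \<Rightarrow> nat" where
  "num_outranking us t =
     card {i. i < length us \<and> t \<le> time (us ! i) \<and> (\<exists>j<length us. i < j \<and> time (us ! j) < t)}"

lemma num_outranking_horizon:
  assumes "is_ranking \<pi> T I us"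
  shows "num_outranking us T = 0"
proof -
  have "time u < T" if "u \<in> set us" for u
    using assms that by (auto simp: is_ranking_def relu_units_def)
  then have "{i. i < length us \<and> T \<le> time (us ! i) \<and> (\<exists>j<length us. i < j \<and> time (us ! j) < T)} = {}"
    by (force simp: not_le[symmetric])
  then show ?thesis by (simp add: num_outranking_def)
qed

lemma num_unstable_outranking_le:
  assumes "is_ranking \<pi> T I us" "t \<le> T"
  shows "num_unstable \<pi> I t + num_outranking us t \<le> num_unstable \<pi> I T"
proof -
  let ?A = "{u \<in> relu_units \<pi> t. unstable I u}"
  let ?N = "{i. i < length us \<and> t \<le> time (us ! i) \<and> (\<exists>j<length us. i < j \<and> time (us ! j) < t)}"
  have us: "distinct us" "set us = {u \<in> relu_units \<pi> T. unstable I u}"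
    using assms(1) by (simp_all add: is_ranking_def)
  have "relu_units \<pi> t \<subseteq> relu_units \<pi> T"
    using assms(2) by (auto simp: relu_units_def)
  then have A: "?A \<subseteq> set us" unfolding us(2) by blast
  have "time u < t" if "u \<in> relu_units \<pi> t" for u
    using that by (auto simp: relu_units_def)
  then have disj: "?A \<inter> (!) us ` ?N = {}" by (auto simp: not_le[symmetric])
  have N: "(!) us ` ?N \<subseteq> set us" by auto
  have "inj_on ((!) us) ?N" by (rule inj_on_nth[OF us(1)]) blast
  then have "card ?A + card ?N = card (?A \<union> (!) us ` ?N)"
    using disj A N by (metis (no_types, lifting) card_Un_disjoint card_image finite_subset List.finite_set)
  also have "\<dots> \<le> card (set us)" using A N by (intro card_mono) simp_all
  finally show ?thesis by (simp add: num_unstable_def num_outranking_def us(2))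
qed


section \<open>ReLU graphs\<close>

definition relu_graph :: "real \<Rightarrow> real \<Rightarrow> (real \<times> real) set" where
  "relu_graph a b = {(s, max s 0) | s. s \<in> {a..b}}"

definition hz_set2 :: "hz \<Rightarrow> (real \<times> real) set" where
  "hz_set2 Z = (\<lambda>z. (z $ 0, z $ 1)) ` hz_set Z"

text \<open>Any choice of exact representations with the required generators is allowed.\<close>

definition relu_graph_family :: "(real \<Rightarrow> real \<Rightarrow> hz) \<Rightarrow> bool" where
  "relu_graph_family G \<longleftrightarrow> (\<forall>a b. a \<le> b \<longrightarrow>
     hz_wf 2 (G a b) \<and> hz_set2 (G a b) = relu_graph a b \<and>
     (if a < 0 \<and> 0 < b
      then dim_col (Gb (G a b)) = 1 \<and> hz_set2 (hz_relax (G a b)) = convex hull (relu_graph a b)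
      else dim_col (Gc (G a b)) = 1 \<and> dim_col (Gb (G a b)) = 0 \<and> dim_vec (rhs (G a b)) = 0))"

text \<open>Such a choice exists.\<close>

definition relu_pm :: "real \<Rightarrow> real \<Rightarrow> hz" where
  "relu_pm a b =
     \<lparr>Gc = mat 2 4 (\<lambda>(i, j). [[a / 2, b / 2, 0, 0], [0, b / 2, 0, 0]] ! i ! j), Gb = 0\<^sub>m 2 1,
      ctr = vec 2 (\<lambda>i. [(a + b) / 2, b / 2] ! i),
      Ac = mat 2 4 (\<lambda>(i, j). [[1, 0, 1, 0], [0, 1, 0, 1]] ! i ! j), Ab = mat 2 1 (\<lambda>(i, j). [[1], [-1]] ! i ! j),
      rhs = vec 2 (\<lambda>i. [-1, -1] ! i)\<rparr>"

definition relu_segment :: "real \<Rightarrow> real \<Rightarrow> hz" where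
  "relu_segment a b =
     \<lparr>Gc = mat 2 1 (\<lambda>(i, j). [[(b - a) / 2], [(max b 0 - max a 0) / 2]] ! i ! j), Gb = 0\<^sub>m 2 0,
      ctr = vec 2 (\<lambda>i. [(a + b) / 2, (max a 0 + max b 0) / 2] ! i),
      Ac = 0\<^sub>m 0 1, Ab = 0\<^sub>m 0 0, rhs = 0\<^sub>v 0\<rparr>"

lemma all_less_numeral: "(\<forall>j<2. P j) \<longleftrightarrow> P 0 \<and> P (1::nat)"
   "(\<forall>j<4. P j) \<longleftrightarrow> P 0 \<and> P (1::nat) \<and> P 2 \<and> P 3"
   "(\<forall>j<5. P j) \<longleftrightarrow> P 0 \<and> P (1::nat) \<and> P 2 \<and> P 3 \<and> P 4"
  by (simp_all add: numeral_eq_Suc All_less_Suc conj_ac)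

lemma carrier_mat_iff: "M \<in> carrier_mat nr nc \<longleftrightarrow> dim_row M = nr \<and> dim_col M = nc"
  by auto

lemma mult_mat_vec_nth: "(M *\<^sub>v x) $ k = (\<Sum>j<nc. M $$ (k, j) * x $ j)"
    if "M \<in> carrier_mat nr nc" "x \<in> carrier_vec nc" "k < nr" for M :: "real mat" and nr nc x k
proof -
  have d: "dim_row M = nr" "dim_col M = nc" "dim_vec x = nc" using that by auto
  have "(M *\<^sub>v x) $ k = scalar_prod (row M k) x" using d that(3) by simp
  also have "\<dots> = (\<Sum>j<nc. row M k $ j * x $ j)" unfolding scalar_prod_def d atLeast0LessThan ..
  also have "\<dots> = (\<Sum>j<nc. M $$ (k, j) * x $ j)"
    by (rule sum.cong[OF refl]) (simp add: d that(3))
  finally show ?thesis .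
qed

lemma hz_set2_iff:
  assumes "hz_wf 2 Z"
  shows "p \<in> hz_set2 Z \<longleftrightarrow> (\<exists>f g. (\<forall>j<dim_col (Gc Z). \<bar>f j\<bar> \<le> 1) \<and> (\<forall>j<dim_col (Gb Z). g j \<in> {-1, 1}) \<and>
     (\<forall>k<dim_vec (rhs Z). (\<Sum>j<dim_col (Gc Z). Ac Z $$ (k, j) * f j) + (\<Sum>j<dim_col (Gb Z). Ab Z $$ (k, j) * g j) = rhs Z $ k) \<and>
     (\<forall>k<2. (if k = 0 then fst p else snd p) =
       (\<Sum>j<dim_col (Gc Z). Gc Z $$ (k, j) * f j) + (\<Sum>j<dim_col (Gb Z). Gb Z $$ (k, j) * g j) + ctr Z $ k))"
    (is "_ = (\<exists>f g. ?Q f g)")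
proof -
  note c = assms[unfolded hz_wf_def]
  have d: "dim_row (Gc Z) = 2" "dim_row (Gb Z) = 2" "dim_vec (ctr Z) = 2"
    "dim_row (Ac Z) = dim_vec (rhs Z)" "dim_row (Ab Z) = dim_vec (rhs Z)"
    using c unfolding carrier_mat_iff by simp_all
  let ?z = "\<lambda>x y. Gc Z *\<^sub>v x + Gb Z *\<^sub>v y + ctr Z"
  have key: "(\<forall>j<dim_col (Gc Z). \<bar>x $ j\<bar> \<le> 1) \<and> (\<forall>j<dim_col (Gb Z). y $ j \<in> {-1, 1}) \<and>
      Ac Z *\<^sub>v x + Ab Z *\<^sub>v y = rhs Z \<and> p = (?z x y $ 0, ?z x y $ 1) \<longleftrightarrow> ?Q (($) x) (($) y)"
    if x: "x \<in> carrier_vec (dim_col (Gc Z))" and y: "y \<in> carrier_vec (dim_col (Gb Z))" for x y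
  proof -
    have "Ac Z *\<^sub>v x + Ab Z *\<^sub>v y = rhs Z \<longleftrightarrow> (\<forall>k<dim_vec (rhs Z). (Ac Z *\<^sub>v x) $ k + (Ab Z *\<^sub>v y) $ k = rhs Z $ k)"
      by (simp add: vec_eq_iff d)
    moreover have "(Ac Z *\<^sub>v x) $ k = (\<Sum>j<dim_col (Gc Z). Ac Z $$ (k, j) * x $ j)"
       "(Ab Z *\<^sub>v y) $ k = (\<Sum>j<dim_col (Gb Z). Ab Z $$ (k, j) * y $ j)" if "k < dim_vec (rhs Z)" for k
      by (rule mult_mat_vec_nth[OF _ _ that]; use c x y in blast)+
    moreover have "?z x y $ k = (\<Sum>j<dim_col (Gc Z). Gc Z $$ (k, j) * x $ j) + (\<Sum>j<dim_col (Gb Z). Gb Z $$ (k, j) * y $ j) + ctr Z $ k"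
      if "k < 2" for k
    proof -
      have "(Gc Z *\<^sub>v x) $ k = (\<Sum>j<dim_col (Gc Z). Gc Z $$ (k, j) * x $ j)"
       "(Gb Z *\<^sub>v y) $ k = (\<Sum>j<dim_col (Gb Z). Gb Z $$ (k, j) * y $ j)"
        by (rule mult_mat_vec_nth[OF _ _ that]; use c x y in blast)+
      moreover have "?z x y $ k = (Gc Z *\<^sub>v x) $ k + (Gb Z *\<^sub>v y) $ k + ctr Z $ k"
        using that by (simp add: d)
      ultimately show ?thesis by simp
    qed
    ultimately show ?thesis by (simp add: all_less_numeral(1) prod_eq_iff)
  qed
  show ?thesis
  proof
    assume "p \<in> hz_set2 Z"
    then obtain x y where x: "x \<in> carrier_vec (dim_col (Gc Z))" and y: "y \<in> carrier_vec (dim_col (Gb Z))"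
      and xy: "(\<forall>j<dim_col (Gc Z). \<bar>x $ j\<bar> \<le> 1) \<and> (\<forall>j<dim_col (Gb Z). y $ j \<in> {-1, 1}) \<and>
      Ac Z *\<^sub>v x + Ab Z *\<^sub>v y = rhs Z \<and> p = (?z x y $ 0, ?z x y $ 1)"
      unfolding hz_set2_def hz_set_def by blast
    have "?Q (($) x) (($) y)" by (rule key[OF x y, THEN iffD1, OF xy])
    then show "\<exists>f g. ?Q f g" by (intro exI)
  next
    assume "\<exists>f g. ?Q f g"
    then obtain f g where Q: "?Q f g" by blast
    let ?x = "vec (dim_col (Gc Z)) f" and ?y = "vec (dim_col (Gb Z)) g"
    have "?Q (($) ?x) (($) ?y)" using Q by simp
    then have "(\<forall>j<dim_col (Gc Z). \<bar>?x $ j\<bar> \<le> 1) \<and> (\<forall>j<dim_col (Gb Z). ?y $ j \<in> {-1, 1}) \<and>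
      Ac Z *\<^sub>v ?x + Ab Z *\<^sub>v ?y = rhs Z \<and> p = (?z ?x ?y $ 0, ?z ?x ?y $ 1)"
      by (rule key[OF vec_carrier vec_carrier, THEN iffD2])
    moreover have "?x \<in> carrier_vec (dim_col (Gc Z))" "?y \<in> carrier_vec (dim_col (Gb Z))" by simp_all
    ultimately have "?z ?x ?y \<in> hz_set Z" "p = (?z ?x ?y $ 0, ?z ?x ?y $ 1)" unfolding hz_set_def by blast+
    then show "p \<in> hz_set2 Z" unfolding hz_set2_def by blast
  qed
qed

lemmas hz_set2_iff' = hz_set2_iff[unfolded all_less_numeral(1), simplified if_True if_False simp_thms one_neq_zero refl]

lemma hz_wf_relu_segment: "hz_wf 2 (relu_segment a b)"
  by (simp add: hz_wf_def relu_segment_def)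

lemma hz_wf_relu_pm: "hz_wf 2 (relu_pm a b)"
  by (simp add: hz_wf_def relu_pm_def)

lemma hz_wf_relax: "hz_wf n Z \<Longrightarrow> hz_wf n (hz_relax Z)"
  unfolding hz_wf_def carrier_mat_iff by (simp add: hz_relax_def append_cols_def)

lemmas hz_wf_relax_relu_pm = hz_wf_relax[OF hz_wf_relu_pm]

lemma hz_set2_relu_segment: "(s, y) \<in> hz_set2 (relu_segment a b) \<longleftrightarrow>
  (\<exists>x. \<bar>x\<bar> \<le> 1 \<and> s = (b-a)/2*x+(a+b)/2 \<and> y = (max b 0 - max a 0)/2*x+(max a 0 + max b 0)/2)"
  unfolding hz_set2_iff'[OF hz_wf_relu_segment]
  by (simp add: relu_segment_def) (rule iffI; elim exE; force)

lemma sum_less_numeral: "(\<Sum>j<4. h j) = h 0 + h (1::nat) + h 2 + h (3::nat)"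
   "(\<Sum>j<5. h j) = h 0 + h (1::nat) + h 2 + h (3::nat) + h 4" for h :: "nat \<Rightarrow> real"
  by (simp_all add: numeral_eq_Suc)

lemma hz_set2_relu_pm: "(s, y) \<in> hz_set2 (relu_pm a b) \<longleftrightarrow>
  (\<exists>f l. (\<forall>j<4. \<bar>f j\<bar> \<le> 1) \<and> l \<in> {-1, 1} \<and> f 0 + f 2 + l = -1 \<and> f 1 + f 3 - l = -1 \<and>
     s = a/2*f 0 + b/2*f (1::nat) + (a+b)/2 \<and> y = b/2*f 1 + b/2)" (is "_ = (\<exists>f l. ?Q f l)")
proof -
  have "(s, y) \<in> hz_set2 (relu_pm a b) \<longleftrightarrow> (\<exists>f g. ?Q f (g (0::nat)))"
    unfolding hz_set2_iff'[OF hz_wf_relu_pm]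
    apply (simp add: relu_pm_def sum_less_numeral)
    apply (simp only: all_less_numeral ex_simps)
    apply (simp add: add.assoc)
    done
  also have "\<dots> \<longleftrightarrow> (\<exists>f l. ?Q f l)"
  proof (intro iffI; elim exE)
    fix f l assume "?Q f l"
    then have "\<exists>g. ?Q f (g (0::nat))" by (intro exI[of _ "\<lambda>_. l"]) simp
    then show "\<exists>f g. ?Q f (g (0::nat))" by blast
  next
    fix f and g :: "nat \<Rightarrow> real" assume "?Q f (g 0)"
    then show "\<exists>f l. ?Q f l" by blast
  qed
  finally show ?thesis .
qed

lemma hz_set2_relax_relu_pm: "(s, y) \<in> hz_set2 (hz_relax (relu_pm a b)) \<longleftrightarrow>
  (\<exists>f l. (\<forall>j<4. \<bar>f j\<bar> \<le> 1) \<and> \<bar>l\<bar> \<le> 1 \<and> f 0 + f 2 + l = -1 \<and> f 1 + f 3 - l = -1 \<and>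
     s = a/2*f 0 + b/2*f (1::nat) + (a+b)/2 \<and> y = b/2*f 1 + b/2)" (is "_ = (\<exists>f l. ?Q f l)")
proof -
  have "(s, y) \<in> hz_set2 (hz_relax (relu_pm a b)) \<longleftrightarrow> (\<exists>f. ?Q f (f (4::nat)))"
    unfolding hz_set2_iff'[OF hz_wf_relax_relu_pm]
    apply (simp add: relu_pm_def hz_relax_def append_cols_def four_block_mat_def Let_def sum_less_numeral)
    apply (simp only: all_less_numeral ex_simps)
    apply (simp add: add.assoc)
    done
  also have "\<dots> \<longleftrightarrow> (\<exists>f l. ?Q f l)"
  proof (intro iffI; elim exE)
    fix f l assume "?Q f l"
    then have "?Q (f(4 := l)) ((f(4 := l)) 4)" by auto
    then show "\<exists>f. ?Q f (f 4)" by blast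
  next
    fix f assume "?Q f (f 4)"
    then show "\<exists>f l. ?Q f l" by blast
  qed
  finally show ?thesis .
qed

lemma pair_set_eqI: "(\<And>s y. (s, y) \<in> A \<longleftrightarrow> (s, y) \<in> B) \<Longrightarrow> A = B"
  by auto

lemma convex_hull_relu_graph: assumes "a < 0" "0 < b"
  shows "convex hull (relu_graph a b) = {(a * u + b * w, b * w) | u w. 0 \<le> u \<and> 0 \<le> w \<and> u + w \<le> 1}" (is "_ = ?R")
proof -
  let ?C = "convex hull {(a, 0), (b, b), (0, 0)}"
  have C: "?C = ?R"
  proof (intro equalityI subsetI)
    fix z assume "z \<in> ?C"
    then obtain u v w where *: "0 \<le> u" "0 \<le> v" "0 \<le> w" "u + v + w = 1"
      "z = u *\<^sub>R (a, 0) + v *\<^sub>R (b, b) + w *\<^sub>R (0, 0)" unfolding convex_hull_3 by blast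
    then have "z = (a * u + b * v, b * v)" "u + v \<le> 1" by (simp_all add: mult.commute)
    with *(1,2) show "z \<in> ?R" by blast
  next
    fix z assume "z \<in> ?R"
    then obtain u w where *: "0 \<le> u" "0 \<le> w" "u + w \<le> 1" "z = (a * u + b * w, b * w)" by blast
    then have "z = u *\<^sub>R (a, 0) + w *\<^sub>R (b, b) + (1 - u - w) *\<^sub>R (0, 0)"
      "0 \<le> 1 - u - w" "u + w + (1 - u - w) = 1" by (simp_all add: mult.commute)
    with *(1,2) show "z \<in> ?C" unfolding convex_hull_3 by blast
  qed
  have "{(a, 0), (b, b), (0, 0)} \<subseteq> relu_graph a b"
    using assms by (auto simp: relu_graph_def)
  then have 1: "?C \<subseteq> convex hull (relu_graph a b)" by (rule hull_mono)
  have "relu_graph a b \<subseteq> ?R"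
  proof (clarsimp simp: relu_graph_def)
    fix s assume s: "a \<le> s" "s \<le> b"
    show "\<exists>u w. s = a * u + b * w \<and> max s 0 = b * w \<and> 0 \<le> u \<and> 0 \<le> w \<and> u + w \<le> 1"
    proof (cases "s \<ge> 0")
      case True then show ?thesis using s assms
        by (intro exI[of _ 0] exI[of _ "s / b"]) auto
    next
      case False then show ?thesis using s assms
        by (intro exI[of _ "s / a"] exI[of _ 0]) (auto simp: divide_simps)
    qed
  qed
  then have "convex hull (relu_graph a b) \<subseteq> ?C" unfolding C[symmetric]
    by (rule hull_minimal) (rule convex_convex_hull)
  then show ?thesis using 1 C by blast
qed

lemma relax_relu_pm_convex_hull: assumes "a < 0" "0 < b"
  shows "hz_set2 (hz_relax (relu_pm a b)) = convex hull (relu_graph a b)"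
proof (rule pair_set_eqI)
  fix s y
  show "(s, y) \<in> hz_set2 (hz_relax (relu_pm a b)) \<longleftrightarrow> (s, y) \<in> convex hull (relu_graph a b)"
    unfolding convex_hull_relu_graph[OF assms]
  proof
    assume "(s, y) \<in> hz_set2 (hz_relax (relu_pm a b))"
    then obtain f l where *: "\<forall>j<4. \<bar>f j\<bar> \<le> 1" "\<bar>l\<bar> \<le> 1" "f 0 + f 2 + l = -1" "f 1 + f 3 - l = -1"
     "s = a/2*f 0 + b/2*f (1::nat) + (a+b)/2" "y = b/2*f 1 + b/2"
      unfolding hz_set2_relax_relu_pm by blast
    then have "\<bar>f 0\<bar> \<le> 1" "\<bar>f 1\<bar> \<le> 1" "\<bar>f 2\<bar> \<le> 1" "\<bar>f 3\<bar> \<le> 1" by auto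
    then have "-1 \<le> f 0" "-1 \<le> f 1" "-1 \<le> f 2" "-1 \<le> f 3" by (simp_all only: abs_le_iff) linarith+
    then have "0 \<le> 1 + f 0" "0 \<le> 1 + f 1" "f 0 + f 1 \<le> 0" using *(3,4) by linarith+
    then have "0 \<le> (1 + f 0) / 2" "0 \<le> (1 + f 1) / 2" "(1 + f 0) / 2 + (1 + f 1) / 2 \<le> 1"
      by (simp_all add: field_simps)
    moreover have "(s, y) = (a * ((1 + f 0) / 2) + b * ((1 + f 1) / 2), b * ((1 + f 1) / 2))"
      unfolding *(5,6) by (simp add: field_simps)
    ultimately show "(s, y) \<in> {(a * u + b * w, b * w) | u w. 0 \<le> u \<and> 0 \<le> w \<and> u + w \<le> 1}"
      by blast
  next
    assume "(s, y) \<in> {(a * u + b * w, b * w) | u w. 0 \<le> u \<and> 0 \<le> w \<and> u + w \<le> 1}"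
    then obtain u w where *: "s = a * u + b * w" "y = b * w" "0 \<le> u" "0 \<le> w" "u + w \<le> 1" by blast
    let ?l = "2 * w - 1"
    show "(s, y) \<in> hz_set2 (hz_relax (relu_pm a b))"
      unfolding hz_set2_relax_relu_pm
      apply (rule exI[of _ "\<lambda>j. [2*u-1, 2*w-1, 1-2*u-2*w, -1] ! j"])
      apply (rule exI[of _ "2*w-1"])
      using * by (auto simp: eval_nat_numeral less_Suc_eq field_simps)
  qed
qed

lemma relu_pm_graph: assumes "a < 0" "0 < b"
  shows "hz_set2 (relu_pm a b) = relu_graph a b"
proof (rule pair_set_eqI)
  fix s y
  show "(s, y) \<in> hz_set2 (relu_pm a b) \<longleftrightarrow> (s, y) \<in> relu_graph a b"
  proof
    assume "(s, y) \<in> hz_set2 (relu_pm a b)"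
    then obtain f l where *: "\<forall>j<4. \<bar>f j\<bar> \<le> 1" "l \<in> {-1,1}" "f 0 + f 2 + l = -1" "f 1 + f 3 - l = -1"
     "s = a/2*f 0 + b/2*f (1::nat) + (a+b)/2" "y = b/2*f 1 + b/2"
      unfolding hz_set2_relu_pm by blast
    then have b: "\<bar>f 0\<bar> \<le> 1" "\<bar>f 1\<bar> \<le> 1" "\<bar>f 2\<bar> \<le> 1" "\<bar>f 3\<bar> \<le> 1" by auto
    have "l = -1 \<or> l = 1" using * by auto
    then show "(s, y) \<in> relu_graph a b"
    proof
      assume "l = -1"
      then have f1: "f 1 = -1" using * b by auto
      then have y: "y = 0" "s = a * ((1 + f 0) / 2)" using * by (auto simp: field_simps)
      have "0 \<le> (1 + f 0) / 2" "(1 + f 0) / 2 \<le> 1" using b by auto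
      then have "s \<le> 0" "a \<le> s" unfolding y using assms
        using mult_left_mono_neg[of 0 "(1 + f 0) / 2" a] mult_left_mono_neg[of "(1 + f 0) / 2" 1 a] by linarith+
      then show ?thesis using y(1) assms by (auto simp: relu_graph_def)
    next
      assume "l = 1"
      then have f0: "f 0 = -1" using * b by auto
      then have y: "y = b * ((1 + f 1) / 2)" "s = y" using * by (auto simp: field_simps)
      have "0 \<le> (1 + f 1) / 2" "(1 + f 1) / 2 \<le> 1" using b by auto
      then have "y \<le> b" "0 \<le> y" unfolding y using assms
        using mult_left_mono[of 0 "(1 + f 1) / 2" b] mult_left_mono[of "(1 + f 1) / 2" 1 b] by linarith+
      then show ?thesis using y(2) assms by (auto simp: relu_graph_def)
    qed
  next
    assume "(s, y) \<in> relu_graph a b"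
    then have s: "a \<le> s" "s \<le> b" "y = max s 0" by (auto simp: relu_graph_def)
    show "(s, y) \<in> hz_set2 (relu_pm a b)"
    proof (cases "0 \<le> s")
      case True
      let ?w = "s / b"
      have "0 \<le> ?w" "?w \<le> 1" "b * ?w = s" using True s assms by auto
      then show ?thesis unfolding hz_set2_relu_pm
        apply (intro exI[of _ "\<lambda>j. [-1, 2*?w-1, -1, 1-2*?w] ! j"] exI[of _ 1])
        using s True by (auto simp: eval_nat_numeral less_Suc_eq field_simps)
    next
      case False
      let ?w = "s / a"
      have "0 \<le> ?w" "?w \<le> 1" "a * ?w = s" using False s assms by (auto simp: divide_simps)
      then show ?thesis unfolding hz_set2_relu_pm
        apply (intro exI[of _ "\<lambda>j. [2*?w-1, -1, 1-2*?w, -1] ! j"] exI[of _ "-1"])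
        using s False by (auto simp: eval_nat_numeral less_Suc_eq field_simps)
    qed
  qed
qed

lemma relu_segment_graph: assumes "a \<le> b" "\<not> (a < 0 \<and> 0 < b)"
  shows "hz_set2 (relu_segment a b) = relu_graph a b"
proof (rule pair_set_eqI)
  fix s y
  have lin: "max s 0 = (max b 0 - max a 0)/2*x+(max a 0 + max b 0)/2 \<and> a \<le> s \<and> s \<le> b"
    if x: "\<bar>x\<bar> \<le> 1" "s = (b-a)/2*x+(a+b)/2" for x
  proof -
    have "s = a + (b - a) * ((1 + x) / 2)" "s = b - (b - a) * ((1 - x) / 2)" using x by (auto simp: field_simps)
    moreover have "0 \<le> (b - a) * ((1 + x) / 2)" "0 \<le> (b - a) * ((1 - x) / 2)" using assms x by auto
    ultimately have "a \<le> s" "s \<le> b" by linarith+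
    moreover have "b \<le> 0 \<or> 0 \<le> a" using assms by auto
    moreover have ?thesis if "b \<le> 0" "a \<le> s" "s \<le> b"
    proof -
      have "max a 0 = 0" "max b 0 = 0" "max s 0 = 0" using that by auto
      then show ?thesis using that by simp
    qed
    moreover have ?thesis if "0 \<le> a" "a \<le> s" "s \<le> b"
    proof -
      have "max a 0 = a" "max b 0 = b" "max s 0 = s" using that by auto
      then show ?thesis using that x by simp
    qed
    ultimately show ?thesis by blast
  qed
  show "(s, y) \<in> hz_set2 (relu_segment a b) \<longleftrightarrow> (s, y) \<in> relu_graph a b"
    unfolding hz_set2_relu_segment
  proof
    assume "\<exists>x. \<bar>x\<bar> \<le> 1 \<and> s = (b-a)/2*x+(a+b)/2 \<and> y = (max b 0 - max a 0)/2*x+(max a 0 + max b 0)/2"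
    then show "(s, y) \<in> relu_graph a b" using lin by (auto simp: relu_graph_def)
  next
    assume "(s, y) \<in> relu_graph a b"
    then have s: "a \<le> s" "s \<le> b" "y = max s 0" by (auto simp: relu_graph_def)
    define x where "x = (if a = b then 0 else (2 * s - a - b) / (b - a))"
    have "\<bar>x\<bar> \<le> 1" "s = (b-a)/2*x+(a+b)/2" using s by (auto simp: x_def abs_le_iff divide_simps)
    then show "\<exists>x. \<bar>x\<bar> \<le> 1 \<and> s = (b-a)/2*x+(a+b)/2 \<and> y = (max b 0 - max a 0)/2*x+(max a 0 + max b 0)/2"
      using lin s(3) by blast
  qed
qed

lemma relu_graph_family_witness:
  "relu_graph_family (\<lambda>a b. if a < 0 \<and> 0 < b then relu_pm a b else relu_segment a b)"
  unfolding relu_graph_family_def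
  by (auto simp: hz_wf_relu_segment hz_wf_relu_pm relax_relu_pm_convex_hull relu_pm_graph relu_segment_graph)
     (auto simp: relu_pm_def relu_segment_def)

definition relaxed_relu :: "(real \<Rightarrow> real \<Rightarrow> hz) \<Rightarrow> real \<times> real \<Rightarrow> nat \<Rightarrow> hz" where
  "relaxed_relu G ab lab =
     (if fst ab < 0 \<and> 0 < snd ab \<and> lab = 1 then hz_relax (G (fst ab) (snd ab)) else G (fst ab) (snd ab))"

text \<open>The units of one layer at one time step are \<open>u 0, \<dots>, u (m - 1)\<close>.\<close>

definition relaxed_relu_box ::
    "(real \<Rightarrow> real \<Rightarrow> hz) \<Rightarrow> boxes \<Rightarrow> (relu_unit \<Rightarrow> nat) \<Rightarrow> (nat \<Rightarrow> relu_unit) \<Rightarrow> nat \<Rightarrow> hz" where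
  "relaxed_relu_box G I lab u m =
     foldr hz_cart (map (\<lambda>i. relaxed_relu G (I (u i)) (lab (u i))) [0..<m]) hz_unit"

text \<open>Maps \<open>(s\<^sub>0, y\<^sub>0, s\<^sub>1, y\<^sub>1, \<dots>)\<close> to \<open>(s\<^sub>0, s\<^sub>1, \<dots>, y\<^sub>0, y\<^sub>1, \<dots>)\<close>.\<close>

definition relu_perm :: "nat \<Rightarrow> real mat" where
  "relu_perm m = mat (2 * m) (2 * m)
     (\<lambda>(i, j). if j = (if i < m then 2 * i else 2 * (i - m) + 1) then 1 else 0)"

definition fst_proj :: "nat \<Rightarrow> real mat" where
  "fst_proj m = append_cols (1\<^sub>m m) (0\<^sub>m m m)"

definition snd_proj :: "nat \<Rightarrow> real mat" where
  "snd_proj m = append_cols (0\<^sub>m m m) (1\<^sub>m m)"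

definition relu_image ::
    "(real \<Rightarrow> real \<Rightarrow> hz) \<Rightarrow> boxes \<Rightarrow> (relu_unit \<Rightarrow> nat) \<Rightarrow> (nat \<Rightarrow> relu_unit) \<Rightarrow> nat \<Rightarrow> hz \<Rightarrow> hz" where
  "relu_image G I lab u m Z =
     hz_linear (snd_proj m)
       (hz_inter (fst_proj m) (hz_linear (relu_perm m) (relaxed_relu_box G I lab u m)) Z)"


section \<open>The relaxed algorithm\<close>

text \<open>There is no set at time \<open>0\<close>; the first equation is a dummy that is never used.\<close>

fun relaxed_hid ::
    "(real \<Rightarrow> real \<Rightarrow> hz) \<Rightarrow> rnn \<Rightarrow> boxes \<Rightarrow> (relu_unit \<Rightarrow> nat) \<Rightarrow> hz \<Rightarrow> nat \<Rightarrow> nat \<Rightarrow> hz" where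
  "relaxed_hid G \<pi> I lab X 0 l = X"
| "relaxed_hid G \<pi> I lab X (Suc 0) 0 = X"
| "relaxed_hid G \<pi> I lab X (Suc (Suc t)) 0 =
     relu_image G I lab (Out (Suc t)) (width \<pi> 0)
       (hz_affine (Wy \<pi>) (vy \<pi>) (relaxed_hid G \<pi> I lab X (Suc t) (depth \<pi>)))"
| "relaxed_hid G \<pi> I lab X (Suc 0) (Suc l) =
     relu_image G I lab (Hid (Suc 0) (Suc l)) (width \<pi> (Suc l))
       (hz_affine (Wx \<pi> (Suc l)) (vh \<pi> (Suc l)) (relaxed_hid G \<pi> I lab X (Suc 0) l))"
| "relaxed_hid G \<pi> I lab X (Suc (Suc t)) (Suc l) =
     relu_image G I lab (Hid (Suc (Suc t)) (Suc l)) (width \<pi> (Suc l))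
       (hz_affine (append_cols (Wh \<pi> (Suc l)) (Wx \<pi> (Suc l))) (vh \<pi> (Suc l))
          (hz_cprod (relaxed_hid G \<pi> I lab X (Suc t) (Suc l))
                    (relaxed_hid G \<pi> I lab X (Suc (Suc t)) l)))"

definition relaxed_pairs ::
    "(real \<Rightarrow> real \<Rightarrow> hz) \<Rightarrow> rnn \<Rightarrow> boxes \<Rightarrow> relu_unit list \<Rightarrow> hz \<Rightarrow> nat \<Rightarrow> nat \<Rightarrow> hz" where
  "relaxed_pairs G \<pi> I us X N t =
     hz_cprod (relaxed_hid G \<pi> I (label us N) X 1 0) (relaxed_hid G \<pi> I (label us N) X t 0)"

definition relaxed_fwd :: "nat \<Rightarrow> hz \<Rightarrow> hz \<Rightarrow> hz" where
  "relaxed_fwd n S X1 = hz_linear (snd_proj n) (hz_inter (fst_proj n) S X1)"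

definition relaxed_bwd :: "nat \<Rightarrow> hz \<Rightarrow> hz \<Rightarrow> hz" where
  "relaxed_bwd n S Tgt = hz_linear (fst_proj n) (hz_inter (snd_proj n) S Tgt)"

end

theory Submission
  imports Defs
begin

text \<open>
  Every set computed by the algorithm is a function of one growing vector of factors: each step keeps
  the factors and constraints of the sets before it and appends those of a ReLU graph. Hence the
  values of all layers at one feasible choice of factors form a relaxed run, a sequence of states
  in which every unit satisfies its ReLU graph or its triangle relaxation, and conversely every
  relaxed run comes from some feasible factors. The pair set therefore consists of the first and last
  states of relaxed runs. True trajectories are relaxed runs since the boxes are sound; they are the
  only ones if no unit of the time steps below \<open>t\<close> is relaxed; and a larger budget leaves fewer
  relaxed units, hence fewer runs.
\<close>

section \<open>Hybrid zonotopes as functions of their factors\<close>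

text \<open>The constrained product is the obstacle to reasoning with sets alone:
  \<open>hz_cprod\<close> is not determined by the sets of its arguments, and a Cartesian product in
  its place would forget that the previous hidden state and the new layer input belong to the same
  trajectory. This dependence lives only in the shared factors. Factors, on the other hand, cannot
  be compared between two budgets: relaxing a unit turns its binary generator into a continuous one
  and so changes the numbers of both kinds. Runs mediate between the two views. They mention no
  factors, and a label enters them only through one planar set per unit, so inclusion, exactness and
  monotonicity reduce to comparing a ReLU graph with its convex hull. Time and layer are merged into
  one index because the algorithm recurses through both; the recurrent weights then become a
  look-back over a fixed distance.\<close>

text \<open>
  Factors are infinite sequences of which only a prefix matters, so that the factors of a set are
  at the same time factors of every set whose generators are a prefix of its own.
\<close>

definition hz_eval :: "hz \<Rightarrow> (nat \<Rightarrow> real) \<Rightarrow> (nat \<Rightarrow> real) \<Rightarrow> real vec" where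
  "hz_eval Z f g = Gc Z *\<^sub>v vec (dim_col (Gc Z)) f + Gb Z *\<^sub>v vec (dim_col (Gb Z)) g + ctr Z"

definition hz_feasible :: "hz \<Rightarrow> (nat \<Rightarrow> real) \<Rightarrow> (nat \<Rightarrow> real) \<Rightarrow> bool" where
  "hz_feasible Z f g \<longleftrightarrow>
     (\<forall>i<dim_col (Gc Z). \<bar>f i\<bar> \<le> 1) \<and> (\<forall>i<dim_col (Gb Z). g i \<in> {-1, 1}) \<and>
     Ac Z *\<^sub>v vec (dim_col (Gc Z)) f + Ab Z *\<^sub>v vec (dim_col (Gb Z)) g = rhs Z"

definition shift :: "nat \<Rightarrow> (nat \<Rightarrow> real) \<Rightarrow> nat \<Rightarrow> real" where
  "shift p f = (\<lambda>i. f (p + i))"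

definition concat_at :: "nat \<Rightarrow> (nat \<Rightarrow> real) \<Rightarrow> (nat \<Rightarrow> real) \<Rightarrow> nat \<Rightarrow> real" where
  "concat_at p f f' = (\<lambda>i. if i < p then f i else f' (i - p))"

lemma shift_concat_at [simp]: "shift p (concat_at p f f') = f'"
  by (simp add: shift_def concat_at_def)

lemma concat_at_less [simp]: "i < p \<Longrightarrow> concat_at p f f' i = f i"
  by (simp add: concat_at_def)

lemma hz_set_eq_eval: "hz_set Z = {hz_eval Z f g | f g. hz_feasible Z f g}"
proof (intro equalityI subsetI)
  fix z assume "z \<in> hz_set Z"
  then obtain x y where xy: "z = Gc Z *\<^sub>v x + Gb Z *\<^sub>v y + ctr Z"
    "x \<in> carrier_vec (dim_col (Gc Z))" "\<forall>i<dim_col (Gc Z). \<bar>x $ i\<bar> \<le> 1"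
    "y \<in> carrier_vec (dim_col (Gb Z))" "\<forall>i<dim_col (Gb Z). y $ i \<in> {-1, 1}"
    "Ac Z *\<^sub>v x + Ab Z *\<^sub>v y = rhs Z" unfolding hz_set_def by blast
  \<comment> \<open>As sequences, \<open>($) x\<close> and \<open>($) y\<close> are unspecified
    beyond the dimension; \<open>vec\<close> cuts that part off.\<close>
  have "vec (dim_col (Gc Z)) (($) x) = x" "vec (dim_col (Gb Z)) (($) y) = y" using xy by auto
  then have "z = hz_eval Z (($) x) (($) y)" "hz_feasible Z (($) x) (($) y)"
    using xy by (simp_all add: hz_eval_def hz_feasible_def)
  then show "z \<in> {hz_eval Z f g | f g. hz_feasible Z f g}" by blast
next
  fix z assume "z \<in> {hz_eval Z f g | f g. hz_feasible Z f g}"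
  then obtain f g where fg: "z = hz_eval Z f g" "hz_feasible Z f g" by blast
  then have "z = Gc Z *\<^sub>v vec (dim_col (Gc Z)) f + Gb Z *\<^sub>v vec (dim_col (Gb Z)) g + ctr Z \<and>
     vec (dim_col (Gc Z)) f \<in> carrier_vec (dim_col (Gc Z)) \<and>
     (\<forall>i<dim_col (Gc Z). \<bar>vec (dim_col (Gc Z)) f $ i\<bar> \<le> 1) \<and>
     vec (dim_col (Gb Z)) g \<in> carrier_vec (dim_col (Gb Z)) \<and>
     (\<forall>i<dim_col (Gb Z). vec (dim_col (Gb Z)) g $ i \<in> {-1, 1}) \<and>
     Ac Z *\<^sub>v vec (dim_col (Gc Z)) f + Ab Z *\<^sub>v vec (dim_col (Gb Z)) g = rhs Z"
    by (simp add: hz_eval_def hz_feasible_def)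
  then show "z \<in> hz_set Z" unfolding hz_set_def by blast
qed

lemma vec_cong: "(\<And>i. i < n \<Longrightarrow> f i = f' i) \<Longrightarrow> vec n f = vec n f'"
  by (intro eq_vecI) auto

text \<open>With \<open>hz_feasible_cong\<close>, this permits overwriting all factors behind the
  prefix that \<open>Z\<close> reads, which is how witnesses for several sets are merged.\<close>

lemma hz_eval_cong:
  assumes "\<And>i. i < dim_col (Gc Z) \<Longrightarrow> f i = f' i" "\<And>i. i < dim_col (Gb Z) \<Longrightarrow> g i = g' i"
  shows "hz_eval Z f g = hz_eval Z f' g'"
  unfolding hz_eval_def using vec_cong[of _ f f', OF assms(1)] vec_cong[of _ g g', OF assms(2)] by simp

lemma hz_feasible_cong:
  assumes "\<And>i. i < dim_col (Gc Z) \<Longrightarrow> f i = f' i" "\<And>i. i < dim_col (Gb Z) \<Longrightarrow> g i = g' i"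
  shows "hz_feasible Z f g \<longleftrightarrow> hz_feasible Z f' g'"
  unfolding hz_feasible_def
  using vec_cong[of _ f f', OF assms(1)] vec_cong[of _ g g', OF assms(2)] assms by auto

section \<open>Block matrices applied to concatenated vectors\<close>

lemma vec_add_eq_append: "vec (p + q) f = vec p f @\<^sub>v vec q (shift p f)"
  by (intro eq_vecI) (auto simp: shift_def)

lemma append_cols_carrier:
  "A \<in> carrier_mat r p \<Longrightarrow> B \<in> carrier_mat r q \<Longrightarrow> append_cols A B \<in> carrier_mat r (p + q)"
  by (auto simp: append_cols_def)

lemma block_diag_carrier:
  "A \<in> carrier_mat r p \<Longrightarrow> B \<in> carrier_mat s q \<Longrightarrow> block_diag A B \<in> carrier_mat (r + s) (p + q)"
  by (auto simp: block_diag_def)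

lemma dim_append_cols [simp]:
  "dim_row (append_cols A B) = dim_row A" "dim_col (append_cols A B) = dim_col A + dim_col B"
  by (simp_all add: append_cols_def)

lemma dim_block_diag [simp]:
  "dim_row (block_diag A B) = dim_row A + dim_row B"
  "dim_col (block_diag A B) = dim_col A + dim_col B"
  by (simp_all add: block_diag_def)

lemma dim_append_rows [simp]:
  "dim_row (A @\<^sub>r B) = dim_row A + dim_row B" "dim_col (A @\<^sub>r B) = dim_col A"
  by (simp_all add: append_rows_def)

lemma zero_mat_mult_vec [simp]:
  "x \<in> carrier_vec c \<Longrightarrow> 0\<^sub>m r c *\<^sub>v x = (0\<^sub>v r :: 'a :: semiring_0 vec)"
  by (intro eq_vecI) auto

lemma append_cols_mult_vec:
  fixes A B :: "real mat"
  assumes "A \<in> carrier_mat r p" "B \<in> carrier_mat r q" "x \<in> carrier_vec p" "y \<in> carrier_vec q"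
  shows "append_cols A B *\<^sub>v (x @\<^sub>v y) = A *\<^sub>v x + B *\<^sub>v y"
proof -
  have d: "dim_col A = p" "dim_col B = q" using assms by auto
  \<comment> \<open>The lower blocks of \<open>append_cols\<close> have no rows, so they contribute
    an empty tail.\<close>
  have "append_cols A B *\<^sub>v (x @\<^sub>v y) = (A *\<^sub>v x + B *\<^sub>v y) @\<^sub>v (0\<^sub>m 0 p *\<^sub>v x + 0\<^sub>m 0 q *\<^sub>v y)"
    unfolding append_cols_def d by (rule four_block_mat_mult_vec) (use assms in auto)
  also have "\<dots> = A *\<^sub>v x + B *\<^sub>v y"
    by (intro eq_vecI) (use assms in auto)
  finally show ?thesis .
qed

lemma block_diag_mult_vec:
  fixes A B :: "real mat"
  assumes A: "A \<in> carrier_mat r p" and B: "B \<in> carrier_mat s q"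
    and x: "x \<in> carrier_vec p" and y: "y \<in> carrier_vec q"
  shows "block_diag A B *\<^sub>v (x @\<^sub>v y) = (A *\<^sub>v x) @\<^sub>v (B *\<^sub>v y)"
proof -
  have d: "dim_row A = r" "dim_col A = p" "dim_row B = s" "dim_col B = q" using A B by auto
  show ?thesis
    unfolding block_diag_def d four_block_mat_mult_vec[OF A zero_carrier_mat zero_carrier_mat B x y]
    using mult_mat_vec_carrier[OF A x] mult_mat_vec_carrier[OF B y] x y by simp
qed

section \<open>The operations on hybrid zonotopes in terms of values and feasibility\<close>

lemma hz_wf_dims:
  assumes "hz_wf n Z"
  shows "ctr Z \<in> carrier_vec n" "Gc Z \<in> carrier_mat n (dim_col (Gc Z))"
    "Gb Z \<in> carrier_mat n (dim_col (Gb Z))" "Ac Z \<in> carrier_mat (dim_vec (rhs Z)) (dim_col (Gc Z))"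
    "Ab Z \<in> carrier_mat (dim_vec (rhs Z)) (dim_col (Gb Z))"
  using assms by (simp_all add: hz_wf_def)

lemma hz_eval_carrier: "hz_wf n Z \<Longrightarrow> hz_eval Z f g \<in> carrier_vec n"
  unfolding hz_wf_def carrier_vec_def by (simp add: hz_eval_def)

lemma hz_set_carrier: "hz_wf n Z \<Longrightarrow> hz_set Z \<subseteq> carrier_vec n"
  unfolding hz_set_eq_eval using hz_eval_carrier by blast

lemma hz_affine_wf:
  "hz_wf n Z \<Longrightarrow> R \<in> carrier_mat m n \<Longrightarrow> v \<in> carrier_vec m \<Longrightarrow> hz_wf m (hz_affine R v Z)"
  unfolding hz_wf_def carrier_mat_iff carrier_vec_def by (simp add: hz_affine_def)

lemma hz_affine_eval:
  assumes wf: "hz_wf n Z" and R: "R \<in> carrier_mat m n" and v: "v \<in> carrier_vec m"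
  shows "hz_eval (hz_affine R v Z) f g = R *\<^sub>v hz_eval Z f g + v"
proof -
  note d = hz_wf_dims[OF wf]
  note carrier = mult_mat_vec_carrier[OF d(2) vec_carrier] mult_mat_vec_carrier[OF d(3) vec_carrier]
  note dist = mult_add_distrib_mat_vec[OF R add_carrier_vec[OF carrier] d(1)]
    mult_add_distrib_mat_vec[OF R carrier]
  note assoc = assoc_mult_mat_vec[OF R d(2) vec_carrier] assoc_mult_mat_vec[OF R d(3) vec_carrier]
  have "dim_row R = m" using R by auto
  then show ?thesis using v
    by (simp add: hz_eval_def hz_affine_def dist assoc) (intro eq_vecI, auto)
qed

lemma hz_affine_feasible: "hz_feasible (hz_affine R v Z) f g \<longleftrightarrow> hz_feasible Z f g"
  by (simp add: hz_feasible_def hz_affine_def)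

lemma hz_affine_dims [simp]:
  "dim_col (Gc (hz_affine R v Z)) = dim_col (Gc Z)" "dim_col (Gb (hz_affine R v Z)) = dim_col (Gb Z)"
  by (simp_all add: hz_affine_def)

lemma hz_linear_wf: "hz_wf n Z \<Longrightarrow> R \<in> carrier_mat m n \<Longrightarrow> hz_wf m (hz_linear R Z)"
  unfolding hz_linear_def by (rule hz_affine_wf) auto

lemma hz_linear_eval:
  "hz_wf n Z \<Longrightarrow> R \<in> carrier_mat m n \<Longrightarrow> hz_eval (hz_linear R Z) f g = R *\<^sub>v hz_eval Z f g"
  unfolding hz_linear_def
  by (subst hz_affine_eval, assumption, assumption) (use hz_eval_carrier in auto)

lemma hz_linear_feasible: "hz_feasible (hz_linear R Z) f g \<longleftrightarrow> hz_feasible Z f g"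
  by (simp add: hz_linear_def hz_affine_feasible)

lemma hz_linear_dims [simp]:
  "dim_col (Gc (hz_linear R Z)) = dim_col (Gc Z)" "dim_col (Gb (hz_linear R Z)) = dim_col (Gb Z)"
  by (simp_all add: hz_linear_def)

lemma hz_set_linear:
  "hz_wf n Z \<Longrightarrow> R \<in> carrier_mat m n \<Longrightarrow> hz_set (hz_linear R Z) = (\<lambda>z. R *\<^sub>v z) ` hz_set Z"
  by (auto simp: hz_set_eq_eval hz_linear_eval hz_linear_feasible)

lemma hz_cart_wf: "hz_wf n Z \<Longrightarrow> hz_wf m Y \<Longrightarrow> hz_wf (n + m) (hz_cart Z Y)"
  unfolding hz_wf_def carrier_mat_iff carrier_vec_def by (simp add: hz_cart_def)

lemma hz_cart_eval:
  assumes Z: "hz_wf n Z" and Y: "hz_wf m Y"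
  shows "hz_eval (hz_cart Z Y) f g =
    hz_eval Z f g @\<^sub>v hz_eval Y (shift (dim_col (Gc Z)) f) (shift (dim_col (Gb Z)) g)"
proof -
  note dZ = hz_wf_dims[OF Z] and dY = hz_wf_dims[OF Y]
  note block = block_diag_mult_vec[OF dZ(2) dY(2) vec_carrier vec_carrier]
    block_diag_mult_vec[OF dZ(3) dY(3) vec_carrier vec_carrier]
  note carrier = mult_mat_vec_carrier[OF dZ(2) vec_carrier] mult_mat_vec_carrier[OF dZ(3) vec_carrier]
    mult_mat_vec_carrier[OF dY(2) vec_carrier] mult_mat_vec_carrier[OF dY(3) vec_carrier]
  have "hz_eval (hz_cart Z Y) f g =
    (Gc Z *\<^sub>v vec (dim_col (Gc Z)) f @\<^sub>v Gc Y *\<^sub>v vec (dim_col (Gc Y)) (shift (dim_col (Gc Z)) f)) +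
    (Gb Z *\<^sub>v vec (dim_col (Gb Z)) g @\<^sub>v Gb Y *\<^sub>v vec (dim_col (Gb Y)) (shift (dim_col (Gb Z)) g)) +
    (ctr Z @\<^sub>v ctr Y)"
    by (simp add: hz_eval_def hz_cart_def vec_add_eq_append block)
  then show ?thesis
    unfolding hz_eval_def
    by (simp add: append_vec_add[OF carrier(1,2,3,4)]
        append_vec_add[OF add_carrier_vec[OF carrier(1,2)] dZ(1) add_carrier_vec[OF carrier(3,4)] dY(1)])
qed

text \<open>The predicate \<open>P\<close> speaks of values, so both the bound on continuous factors
  and the two-point condition on binary ones are instances.\<close>

lemma all_less_add_iff:
  fixes p q :: nat and P :: "real \<Rightarrow> bool"
  shows "(\<forall>i<p + q. P (f i)) \<longleftrightarrow> (\<forall>i<p. P (f i)) \<and> (\<forall>i<q. P (shift p f i))"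
proof (intro iffI conjI allI impI)
  fix i assume *: "(\<forall>i<p. P (f i)) \<and> (\<forall>i<q. P (shift p f i))" and i: "i < p + q"
  show "P (f i)"
  proof (cases "i < p")
    case False
    then have "P (shift p f (i - p))" using * i by auto
    with False show ?thesis by (simp add: shift_def)
  qed (use * in simp)
qed (auto simp: shift_def)

lemma hz_cart_feasible:
  assumes Z: "hz_wf n Z" and Y: "hz_wf m Y"
  shows "hz_feasible (hz_cart Z Y) f g \<longleftrightarrow>
    hz_feasible Z f g \<and> hz_feasible Y (shift (dim_col (Gc Z)) f) (shift (dim_col (Gb Z)) g)"
proof -
  note dZ = hz_wf_dims[OF Z] and dY = hz_wf_dims[OF Y]
  note block = block_diag_mult_vec[OF dZ(4) dY(4) vec_carrier vec_carrier]
    block_diag_mult_vec[OF dZ(5) dY(5) vec_carrier vec_carrier]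
  note carrier = mult_mat_vec_carrier[OF dZ(4) vec_carrier] mult_mat_vec_carrier[OF dZ(5) vec_carrier]
    mult_mat_vec_carrier[OF dY(4) vec_carrier] mult_mat_vec_carrier[OF dY(5) vec_carrier]
  have "Ac (hz_cart Z Y) *\<^sub>v vec (dim_col (Gc (hz_cart Z Y))) f +
        Ab (hz_cart Z Y) *\<^sub>v vec (dim_col (Gb (hz_cart Z Y))) g = rhs (hz_cart Z Y) \<longleftrightarrow>
      Ac Z *\<^sub>v vec (dim_col (Gc Z)) f + Ab Z *\<^sub>v vec (dim_col (Gb Z)) g = rhs Z \<and>
      Ac Y *\<^sub>v vec (dim_col (Gc Y)) (shift (dim_col (Gc Z)) f) +
      Ab Y *\<^sub>v vec (dim_col (Gb Y)) (shift (dim_col (Gb Z)) g) = rhs Y"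
    by (simp add: hz_cart_def vec_add_eq_append block append_vec_add[OF carrier(1,2,3,4)]
        append_vec_eq[OF add_carrier_vec[OF carrier(1,2)] carrier_vecI[OF refl]])
  moreover have "(\<forall>i<dim_col (Gc (hz_cart Z Y)). \<bar>f i\<bar> \<le> 1) \<longleftrightarrow> (\<forall>i<dim_col (Gc Z). \<bar>f i\<bar> \<le> 1) \<and>
      (\<forall>i<dim_col (Gc Y). \<bar>shift (dim_col (Gc Z)) f i\<bar> \<le> 1)"
    unfolding hz_cart_def by (simp only: hz.simps dim_block_diag all_less_add_iff[where P = "\<lambda>s. \<bar>s\<bar> \<le> 1"])
  moreover have "(\<forall>i<dim_col (Gb (hz_cart Z Y)). g i \<in> {-1, 1}) \<longleftrightarrow> (\<forall>i<dim_col (Gb Z). g i \<in> {-1, 1}) \<and>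
      (\<forall>i<dim_col (Gb Y). shift (dim_col (Gb Z)) g i \<in> {-1, 1})"
    unfolding hz_cart_def by (simp only: hz.simps dim_block_diag all_less_add_iff[where P = "\<lambda>s. s \<in> {-1, 1}"])
  ultimately show ?thesis
    unfolding hz_feasible_def by blast
qed

lemma hz_inter_dims [simp]:
  "dim_col (Gc (hz_inter R Z Y)) = dim_col (Gc Y) + dim_col (Gc Z)"
  "dim_col (Gb (hz_inter R Z Y)) = dim_col (Gb Y) + dim_col (Gb Z)"
  by (simp_all add: hz_inter_def)

lemma hz_inter_wf:
  "hz_wf n Z \<Longrightarrow> hz_wf m Y \<Longrightarrow> R \<in> carrier_mat m n \<Longrightarrow> hz_wf n (hz_inter R Z Y)"
  unfolding hz_wf_def carrier_mat_iff carrier_vec_def by (simp add: hz_inter_def)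

text \<open>The factors of \<open>Y\<close> stand in front, hence the shift for \<open>Z\<close>. In
  the algorithm \<open>Y\<close> is built from the sets computed so far, so old factors keep their
  positions and new ones are appended.\<close>

lemma hz_inter_eval:
  assumes Z: "hz_wf n Z"
  shows "hz_eval (hz_inter R Z Y) f g =
    hz_eval Z (shift (dim_col (Gc Y)) f) (shift (dim_col (Gb Y)) g)"
proof -
  note d = hz_wf_dims[OF Z]
  have r: "dim_row (Gc Z) = n" "dim_row (Gb Z) = n" using d(2,3) by auto
  note cols = append_cols_mult_vec[OF zero_carrier_mat d(2) vec_carrier vec_carrier]
    append_cols_mult_vec[OF zero_carrier_mat d(3) vec_carrier vec_carrier]
  show ?thesis
    using mult_mat_vec_carrier[OF d(2) vec_carrier] mult_mat_vec_carrier[OF d(3) vec_carrier]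
    by (simp add: hz_eval_def hz_inter_def vec_add_eq_append cols r)
qed

lemma append_vec_assoc: "(a @\<^sub>v b) @\<^sub>v c = a @\<^sub>v (b @\<^sub>v c)"
  by (intro eq_vecI) (auto simp: append_vec_def Let_def)

text \<open>This reads the last constraint block of \<open>hz_inter\<close>: \<open>a\<close>,
  \<open>a'\<close>, \<open>c\<close> are the three summands of the value of \<open>Y\<close>, and
  \<open>b\<close>, \<open>b'\<close>, \<open>d\<close> those of \<open>R\<close> applied to the
  value of \<open>Z\<close>.\<close>

lemma sum_diff_vec_eq_iff:
  fixes a b c :: "real vec"
  assumes "a \<in> carrier_vec k" "b \<in> carrier_vec k" "a' \<in> carrier_vec k" "b' \<in> carrier_vec k"
    "c \<in> carrier_vec k" "d \<in> carrier_vec k"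
  shows "(- a + b) + (- a' + b') = c - d \<longleftrightarrow> b + b' + d = a + a' + c"
proof -
  have "- a $ i + b $ i + (- a' $ i + b' $ i) = c $ i - d $ i \<longleftrightarrow>
      b $ i + b' $ i + d $ i = a $ i + a' $ i + c $ i" for i
    by (rule iffI; linarith)
  then show ?thesis using assms by (auto simp: vec_eq_iff)
qed

text \<open>The three block rows of the constraint separate: the first two are the constraints of
  \<open>Y\<close> and of \<open>Z\<close>, and the third couples the two values.\<close>

lemma hz_inter_feasible:
  assumes Z: "hz_wf n Z" and Y: "hz_wf m Y" and R: "R \<in> carrier_mat m n"
  shows "hz_feasible (hz_inter R Z Y) f g \<longleftrightarrow>
    hz_feasible Y f g \<and> hz_feasible Z (shift (dim_col (Gc Y)) f) (shift (dim_col (Gb Y)) g) \<and>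
    R *\<^sub>v hz_eval Z (shift (dim_col (Gc Y)) f) (shift (dim_col (Gb Y)) g) = hz_eval Y f g"
proof -
  note dZ = hz_wf_dims[OF Z] and dY = hz_wf_dims[OF Y]
  let ?f = "shift (dim_col (Gc Y)) f" and ?g = "shift (dim_col (Gb Y)) g"
  let ?I = "hz_inter R Z Y"
  let ?fY = "vec (dim_col (Gc Y)) f" and ?gY = "vec (dim_col (Gb Y)) g"
  let ?fZ = "vec (dim_col (Gc Z)) ?f" and ?gZ = "vec (dim_col (Gb Z)) ?g"
  have RG: "R * Gc Z \<in> carrier_mat m (dim_col (Gc Z))" "R * Gb Z \<in> carrier_mat m (dim_col (Gb Z))"
    by (rule mult_carrier_mat[OF R dZ(2)] mult_carrier_mat[OF R dZ(3)])+
  have neg: "- Gc Y \<in> carrier_mat m (dim_col (Gc Y))" "- Gb Y \<in> carrier_mat m (dim_col (Gb Y))"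
    using dY(2,3) by (simp_all only: uminus_carrier_iff_mat)
  note blk = block_diag_carrier[OF dY(4) dZ(4)] block_diag_carrier[OF dY(5) dZ(5)]
  note col = append_cols_carrier[OF neg(1) RG(1)] append_cols_carrier[OF neg(2) RG(2)]
  note blk_eq = block_diag_mult_vec[OF dY(4) dZ(4) vec_carrier vec_carrier]
    block_diag_mult_vec[OF dY(5) dZ(5) vec_carrier vec_carrier]
  note col_eq = append_cols_mult_vec[OF neg(1) RG(1) vec_carrier vec_carrier]
    append_cols_mult_vec[OF neg(2) RG(2) vec_carrier vec_carrier]
  note cZ = mult_mat_vec_carrier[OF dZ(2) vec_carrier] mult_mat_vec_carrier[OF dZ(3) vec_carrier]
  note cY = mult_mat_vec_carrier[OF dY(2) vec_carrier] mult_mat_vec_carrier[OF dY(3) vec_carrier]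
  note cA = mult_mat_vec_carrier[OF dY(4) vec_carrier] mult_mat_vec_carrier[OF dY(5) vec_carrier]
    mult_mat_vec_carrier[OF dZ(4) vec_carrier] mult_mat_vec_carrier[OF dZ(5) vec_carrier]
  note dist = mult_add_distrib_mat_vec[OF R add_carrier_vec[OF cZ] dZ(1)]
    mult_add_distrib_mat_vec[OF R cZ]
  note assoc = assoc_mult_mat_vec[OF R dZ(2) vec_carrier] assoc_mult_mat_vec[OF R dZ(3) vec_carrier]
  have 1: "Ac ?I *\<^sub>v vec (dim_col (Gc ?I)) f =
      ((Ac Y *\<^sub>v ?fY) @\<^sub>v (Ac Z *\<^sub>v ?fZ)) @\<^sub>v (- (Gc Y *\<^sub>v ?fY) + R *\<^sub>v (Gc Z *\<^sub>v ?fZ))"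
    using mat_mult_append[OF blk(1) col(1), of "?fY @\<^sub>v ?fZ"]
    by (simp add: hz_inter_def vec_add_eq_append blk_eq col_eq assoc)
  have 2: "Ab ?I *\<^sub>v vec (dim_col (Gb ?I)) g =
      ((Ab Y *\<^sub>v ?gY) @\<^sub>v (Ab Z *\<^sub>v ?gZ)) @\<^sub>v (- (Gb Y *\<^sub>v ?gY) + R *\<^sub>v (Gb Z *\<^sub>v ?gZ))"
    using mat_mult_append[OF blk(2) col(2), of "?gY @\<^sub>v ?gZ"]
    by (simp add: hz_inter_def vec_add_eq_append blk_eq col_eq assoc)
  have RcZ: "R *\<^sub>v (Gc Z *\<^sub>v ?fZ) \<in> carrier_vec m" "R *\<^sub>v (Gb Z *\<^sub>v ?gZ) \<in> carrier_vec m"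
    "R *\<^sub>v ctr Z \<in> carrier_vec m"
    using R cZ dZ(1) by (blast intro: mult_mat_vec_carrier)+
  have c3: "- (Gc Y *\<^sub>v ?fY) + R *\<^sub>v (Gc Z *\<^sub>v ?fZ) \<in> carrier_vec m"
    "- (Gb Y *\<^sub>v ?gY) + R *\<^sub>v (Gb Z *\<^sub>v ?gZ) \<in> carrier_vec m"
    using RcZ(1,2) cY by simp_all
  have 0: "(- (Gc Y *\<^sub>v ?fY) + R *\<^sub>v (Gc Z *\<^sub>v ?fZ)) + (- (Gb Y *\<^sub>v ?gY) + R *\<^sub>v (Gb Z *\<^sub>v ?gZ)) =
        ctr Y - R *\<^sub>v ctr Z \<longleftrightarrow> R *\<^sub>v hz_eval Z ?f ?g = hz_eval Y f g"
    unfolding hz_eval_def dist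
    by (rule sum_diff_vec_eq_iff[OF cY(1) RcZ(1) cY(2) RcZ(2) dY(1) RcZ(3)])
  have 3: "Ac ?I *\<^sub>v vec (dim_col (Gc ?I)) f + Ab ?I *\<^sub>v vec (dim_col (Gb ?I)) g = rhs ?I \<longleftrightarrow>
      Ac Y *\<^sub>v ?fY + Ab Y *\<^sub>v ?gY = rhs Y \<and> Ac Z *\<^sub>v ?fZ + Ab Z *\<^sub>v ?gZ = rhs Z \<and>
      R *\<^sub>v hz_eval Z ?f ?g = hz_eval Y f g"
    unfolding 1 2 0[symmetric]
      append_vec_add[OF append_carrier_vec[OF cA(1,3)] append_carrier_vec[OF cA(2,4)] c3]
      append_vec_add[OF cA(1,2,3,4)]
    by (simp add: hz_inter_def append_vec_assoc append_vec_eq[OF add_carrier_vec[OF cA(1,2)] carrier_vecI[OF refl]]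
        append_vec_eq[OF add_carrier_vec[OF cA(3,4)] carrier_vecI[OF refl]])
  have "(\<forall>i<dim_col (Gc ?I). \<bar>f i\<bar> \<le> 1) \<longleftrightarrow>
      (\<forall>i<dim_col (Gc Y). \<bar>f i\<bar> \<le> 1) \<and> (\<forall>i<dim_col (Gc Z). \<bar>?f i\<bar> \<le> 1)"
    unfolding hz_inter_dims by (rule all_less_add_iff[where P = "\<lambda>s. \<bar>s\<bar> \<le> 1"])
  moreover have "(\<forall>i<dim_col (Gb ?I). g i \<in> {-1, 1}) \<longleftrightarrow>
      (\<forall>i<dim_col (Gb Y). g i \<in> {-1, 1}) \<and> (\<forall>i<dim_col (Gb Z). ?g i \<in> {-1, 1})"
    unfolding hz_inter_dims by (rule all_less_add_iff[where P = "\<lambda>s. s \<in> {-1, 1}"])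
  ultimately show ?thesis
    unfolding hz_feasible_def[of ?I] 3 unfolding hz_feasible_def by blast
qed

lemma hz_set_inter:
  assumes Z: "hz_wf n Z" and Y: "hz_wf m Y" and R: "R \<in> carrier_mat m n"
  shows "hz_set (hz_inter R Z Y) = {z \<in> hz_set Z. R *\<^sub>v z \<in> hz_set Y}"
proof (intro equalityI subsetI)
  fix z assume "z \<in> hz_set (hz_inter R Z Y)"
  then show "z \<in> {z \<in> hz_set Z. R *\<^sub>v z \<in> hz_set Y}"
    unfolding hz_set_eq_eval hz_inter_feasible[OF assms] hz_inter_eval[OF Z] by blast
next
  fix z assume "z \<in> {z \<in> hz_set Z. R *\<^sub>v z \<in> hz_set Y}"
  then obtain f g f' g' where *: "z = hz_eval Z f g" "hz_feasible Z f g"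
    "R *\<^sub>v z = hz_eval Y f' g'" "hz_feasible Y f' g'"
    unfolding hz_set_eq_eval by blast
  \<comment> \<open>The two memberships come with unrelated factors; they are glued in the column
    order of \<open>hz_inter\<close>, those of \<open>Y\<close> first.\<close>
  let ?f = "concat_at (dim_col (Gc Y)) f' f" and ?g = "concat_at (dim_col (Gb Y)) g' g"
  have "hz_eval Y ?f ?g = hz_eval Y f' g'" "hz_feasible Y ?f ?g = hz_feasible Y f' g'"
    by (auto intro!: hz_eval_cong hz_feasible_cong)
  then have "hz_feasible (hz_inter R Z Y) ?f ?g" "z = hz_eval (hz_inter R Z Y) ?f ?g"
    using * by (simp_all add: hz_inter_feasible[OF assms] hz_inter_eval[OF Z])
  then show "z \<in> hz_set (hz_inter R Z Y)" unfolding hz_set_eq_eval by blast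
qed

lemma hz_set_cart:
  assumes Z: "hz_wf n Z" and Y: "hz_wf m Y"
  shows "hz_set (hz_cart Z Y) = {z @\<^sub>v y | z y. z \<in> hz_set Z \<and> y \<in> hz_set Y}"
proof (intro equalityI subsetI)
  fix z assume "z \<in> hz_set (hz_cart Z Y)"
  then show "z \<in> {z @\<^sub>v y | z y. z \<in> hz_set Z \<and> y \<in> hz_set Y}"
    unfolding hz_set_eq_eval hz_cart_feasible[OF assms] hz_cart_eval[OF assms] by blast
next
  fix w assume "w \<in> {z @\<^sub>v y | z y. z \<in> hz_set Z \<and> y \<in> hz_set Y}"
  then obtain f g f' g' where *: "w = hz_eval Z f g @\<^sub>v hz_eval Y f' g'" "hz_feasible Z f g"
    "hz_feasible Y f' g'"
    unfolding hz_set_eq_eval by blast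
  let ?f = "concat_at (dim_col (Gc Z)) f f'" and ?g = "concat_at (dim_col (Gb Z)) g g'"
  have "hz_eval Z ?f ?g = hz_eval Z f g" "hz_feasible Z ?f ?g = hz_feasible Z f g"
    by (auto intro!: hz_eval_cong hz_feasible_cong)
  then have "hz_feasible (hz_cart Z Y) ?f ?g" "w = hz_eval (hz_cart Z Y) ?f ?g"
    using * by (simp_all add: hz_cart_feasible[OF assms] hz_cart_eval[OF assms])
  then show "w \<in> hz_set (hz_cart Z Y)" unfolding hz_set_eq_eval by blast
qed

lemma hz_cprod_wf:
  assumes "hz_wf n Z" "hz_wf m Y"
    "dim_col (Gc Z) \<le> dim_col (Gc Y)" "dim_col (Gb Z) \<le> dim_col (Gb Y)"
  shows "hz_wf (n + m) (hz_cprod Z Y)"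
  using assms unfolding hz_wf_def carrier_mat_iff carrier_vec_def by (simp add: hz_cprod_def)

lemma hz_cprod_dims:
  "dim_col (Gc Z) \<le> dim_col (Gc Y) \<Longrightarrow> dim_col (Gc (hz_cprod Z Y)) = dim_col (Gc Y)"
  "dim_col (Gb Z) \<le> dim_col (Gb Y) \<Longrightarrow> dim_col (Gb (hz_cprod Z Y)) = dim_col (Gb Y)"
  by (simp_all add: hz_cprod_def)

text \<open>The product carries the constraints of \<open>Y\<close> alone. In the algorithm these
  include the constraints of \<open>Z\<close>, because every step preserves the earlier ones
  (\<open>relu_imageD\<close>).\<close>

lemma hz_cprod_feasible:
  assumes "dim_col (Gc Z) \<le> dim_col (Gc Y)" "dim_col (Gb Z) \<le> dim_col (Gb Y)"
  shows "hz_feasible (hz_cprod Z Y) f g \<longleftrightarrow> hz_feasible Y f g"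
  using assms by (simp add: hz_feasible_def hz_cprod_def)

lemma pad_rows_mult_vec:
  fixes A B :: "real mat"
  assumes A: "A \<in> carrier_mat n p" and B: "B \<in> carrier_mat m q" and le: "p \<le> q"
  shows "(append_cols A (0\<^sub>m n (q - p)) @\<^sub>r B) *\<^sub>v vec q f = (A *\<^sub>v vec p f) @\<^sub>v (B *\<^sub>v vec q f)"
proof -
  have split: "vec q f = vec p f @\<^sub>v vec (q - p) (shift p f)"
    using vec_add_eq_append[of p "q - p" f] le by simp
  have "append_cols A (0\<^sub>m n (q - p)) \<in> carrier_mat n q"
    using append_cols_carrier[OF A zero_carrier_mat, of "q - p"] le by simp
  then have "(append_cols A (0\<^sub>m n (q - p)) @\<^sub>r B) *\<^sub>v vec q f =
      (append_cols A (0\<^sub>m n (q - p)) *\<^sub>v vec q f) @\<^sub>v (B *\<^sub>v vec q f)"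
    by (rule mat_mult_append[OF _ B vec_carrier])
  also have "append_cols A (0\<^sub>m n (q - p)) *\<^sub>v vec q f = A *\<^sub>v vec p f"
    unfolding split append_cols_mult_vec[OF A zero_carrier_mat vec_carrier vec_carrier]
    using mult_mat_vec_carrier[OF A vec_carrier] by simp
  finally show ?thesis .
qed

text \<open>Both components read the same sequences from their beginning, in contrast to
  \<open>hz_cart_eval\<close>, where the second one reads shifted sequences and is therefore
  independent of the first.\<close>

lemma hz_cprod_eval:
  assumes Z: "hz_wf n Z" and Y: "hz_wf m Y"
    and le: "dim_col (Gc Z) \<le> dim_col (Gc Y)" "dim_col (Gb Z) \<le> dim_col (Gb Y)"
  shows "hz_eval (hz_cprod Z Y) f g = hz_eval Z f g @\<^sub>v hz_eval Y f g"
proof -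
  note dZ = hz_wf_dims[OF Z] and dY = hz_wf_dims[OF Y]
  have r: "dim_row (Gc Z) = n" "dim_row (Gb Z) = n" using dZ(2,3) by auto
  note pad = pad_rows_mult_vec[OF dZ(2) dY(2) le(1)] pad_rows_mult_vec[OF dZ(3) dY(3) le(2)]
  note carrier = mult_mat_vec_carrier[OF dZ(2) vec_carrier] mult_mat_vec_carrier[OF dZ(3) vec_carrier]
    mult_mat_vec_carrier[OF dY(2) vec_carrier] mult_mat_vec_carrier[OF dY(3) vec_carrier]
  have "hz_eval (hz_cprod Z Y) f g =
    (Gc Z *\<^sub>v vec (dim_col (Gc Z)) f @\<^sub>v Gc Y *\<^sub>v vec (dim_col (Gc Y)) f) +
    (Gb Z *\<^sub>v vec (dim_col (Gb Z)) g @\<^sub>v Gb Y *\<^sub>v vec (dim_col (Gb Y)) g) +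
    (ctr Z @\<^sub>v ctr Y)"
    using le by (simp add: hz_eval_def hz_cprod_def r pad)
  then show ?thesis
    unfolding hz_eval_def
    by (simp add: append_vec_add[OF carrier(1,2,3,4)]
        append_vec_add[OF add_carrier_vec[OF carrier(1,2)] dZ(1) add_carrier_vec[OF carrier(3,4)] dY(1)])
qed

section \<open>The image under a relaxed ReLU layer\<close>

lemma hz_relaxed_relu_wf:
  "relu_graph_family G \<Longrightarrow> fst ab \<le> snd ab \<Longrightarrow> hz_wf 2 (relaxed_relu G ab lab)"
  by (simp add: relaxed_relu_def relu_graph_family_def hz_wf_relax)

lemma hz_unit_wf: "hz_wf 0 hz_unit"
  by (simp add: hz_wf_def hz_unit_def)

lemma hz_set_unit: "hz_set hz_unit = {0\<^sub>v 0}"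
proof -
  have "hz_eval hz_unit f g = 0\<^sub>v 0" "hz_feasible hz_unit f g" for f g
    by (auto simp: hz_eval_def hz_feasible_def hz_unit_def)
  then show ?thesis unfolding hz_set_eq_eval by auto
qed

lemma hz_carts_wf:
  "(\<And>Z. Z \<in> set Zs \<Longrightarrow> hz_wf 2 Z) \<Longrightarrow> hz_wf (2 * length Zs) (foldr hz_cart Zs hz_unit)"
proof (induction Zs)
  case (Cons Z Zs)
  then have "hz_wf (2 + 2 * length Zs) (hz_cart Z (foldr hz_cart Zs hz_unit))"
    by (intro hz_cart_wf) auto
  then show ?case by simp
qed (simp add: hz_unit_wf)

text \<open>Unit \<open>i\<close> owns the adjacent coordinates \<open>2 * i\<close> and
  \<open>2 * i + 1\<close>, so removing the first set shifts all indices by one pair.\<close>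

lemma hz_set_carts:
  assumes "\<And>Z. Z \<in> set Zs \<Longrightarrow> hz_wf 2 Z"
  shows "z \<in> hz_set (foldr hz_cart Zs hz_unit) \<longleftrightarrow>
    z \<in> carrier_vec (2 * length Zs) \<and> (\<forall>i<length Zs. (z $ (2 * i), z $ (2 * i + 1)) \<in> hz_set2 (Zs ! i))"
  using assms
proof (induction Zs arbitrary: z)
  case Nil
  then show ?case by (auto simp: hz_set_unit)
next
  case (Cons Z Zs)
  let ?Y = "foldr hz_cart Zs hz_unit" and ?m = "length Zs"
  have Z: "hz_wf 2 Z" and Y: "hz_wf (2 * ?m) ?Y"
    using Cons.prems hz_carts_wf[of Zs] by auto
  have IH: "y \<in> hz_set ?Y \<longleftrightarrow> y \<in> carrier_vec (2 * ?m) \<and>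
      (\<forall>i<?m. (y $ (2 * i), y $ (2 * i + 1)) \<in> hz_set2 (Zs ! i))" for y
    using Cons by simp
  have all: "(\<forall>i<Suc ?m. P i) \<longleftrightarrow> P 0 \<and> (\<forall>i<?m. P (Suc i))" for P
    by (rule All_less_Suc2)
  show ?case
  proof
    assume "z \<in> hz_set (foldr hz_cart (Z # Zs) hz_unit)"
    then obtain a b where ab: "z = a @\<^sub>v b" "a \<in> hz_set Z" "b \<in> hz_set ?Y"
      using hz_set_cart[OF Z Y] by auto
    have c: "dim_vec a = 2" "dim_vec b = 2 * ?m"
      using ab hz_set_carrier[OF Z] hz_set_carrier[OF Y] by auto
    have "(a $ 0, a $ 1) \<in> hz_set2 Z" using ab(2) by (auto simp: hz_set2_def)
    moreover have "z $ 0 = a $ 0" "z $ 1 = a $ 1" using c by (auto simp: ab(1))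
    moreover have "z $ (2 * Suc i) = b $ (2 * i)" "z $ (2 * Suc i + 1) = b $ (2 * i + 1)" if "i < ?m" for i
      using c that by (auto simp: ab(1))
    moreover have "z \<in> carrier_vec (2 * length (Z # Zs))" by (rule carrier_vecI) (simp add: ab(1) c)
    ultimately show "z \<in> carrier_vec (2 * length (Z # Zs)) \<and>
        (\<forall>i<length (Z # Zs). (z $ (2 * i), z $ (2 * i + 1)) \<in> hz_set2 ((Z # Zs) ! i))"
      using IH[of b] ab(3) unfolding length_Cons all by simp
  next
    assume z: "z \<in> carrier_vec (2 * length (Z # Zs)) \<and>
        (\<forall>i<length (Z # Zs). (z $ (2 * i), z $ (2 * i + 1)) \<in> hz_set2 ((Z # Zs) ! i))"
    then have *: "dim_vec z = 2 + 2 * ?m" "(z $ 0, z $ 1) \<in> hz_set2 Z"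
      "\<forall>i<?m. (z $ (2 * Suc i), z $ (2 * Suc i + 1)) \<in> hz_set2 (Zs ! i)"
      unfolding length_Cons all by auto
    obtain a where a: "a \<in> hz_set Z" "z $ 0 = a $ 0" "z $ 1 = a $ 1"
      using *(2) by (auto simp: hz_set2_def)
    have da: "dim_vec a = 2" using a(1) hz_set_carrier[OF Z] by auto
    define b where "b = vec (2 * ?m) (\<lambda>i. z $ (i + 2))"
    have "z = a @\<^sub>v b"
    proof (rule eq_vecI)
      fix i assume "i < dim_vec (a @\<^sub>v b)"
      moreover have "i < 2 \<Longrightarrow> i = 0 \<or> i = 1" "\<not> i < 2 \<Longrightarrow> Suc (Suc (i - 2)) = i" by auto
      ultimately show "z $ i = (a @\<^sub>v b) $ i" using a(2,3) da by (auto simp: b_def)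
    qed (use da * in \<open>simp add: b_def\<close>)
    moreover have "b \<in> hz_set ?Y" unfolding IH using *(3) by (auto simp: b_def)
    ultimately show "z \<in> hz_set (foldr hz_cart (Z # Zs) hz_unit)"
      using hz_set_cart[OF Z Y] a(1) by auto
  qed
qed

section \<open>Projections, the coordinate permutation, and one layer of units\<close>

lemma fst_proj_carrier: "fst_proj n \<in> carrier_mat n (2 * n)"
  unfolding fst_proj_def mult_2 by (intro append_cols_carrier) auto

lemma snd_proj_carrier: "snd_proj n \<in> carrier_mat n (2 * n)"
  unfolding snd_proj_def mult_2 by (intro append_cols_carrier) auto

lemma fst_proj_append:
  "a \<in> carrier_vec n \<Longrightarrow> b \<in> carrier_vec n \<Longrightarrow> fst_proj n *\<^sub>v (a @\<^sub>v b) = a"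
  unfolding fst_proj_def by (subst append_cols_mult_vec[where r = n and p = n and q = n]) auto

lemma snd_proj_append:
  "a \<in> carrier_vec n \<Longrightarrow> b \<in> carrier_vec n \<Longrightarrow> snd_proj n *\<^sub>v (a @\<^sub>v b) = b"
  unfolding snd_proj_def by (subst append_cols_mult_vec[where r = n and p = n and q = n]) auto

lemma relu_perm_carrier: "relu_perm m \<in> carrier_mat (2 * m) (2 * m)"
  by (simp add: relu_perm_def)

lemma relu_perm_mult_vec:
  assumes z: "z \<in> carrier_vec (2 * m)"
  shows "relu_perm m *\<^sub>v z = vec m (\<lambda>i. z $ (2 * i)) @\<^sub>v vec m (\<lambda>i. z $ (2 * i + 1))"
proof (rule eq_vecI)
  fix i assume "i < dim_vec (vec m (\<lambda>i. z $ (2 * i)) @\<^sub>v vec m (\<lambda>i. z $ (2 * i + 1)))"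
  then have i: "i < 2 * m" by simp
  \<comment> \<open>The column of the only nonzero entry in row \<open>i\<close>; the sum collapses
    to this term.\<close>
  let ?k = "if i < m then 2 * i else 2 * (i - m) + 1"
  have k: "?k < 2 * m" using i by auto
  have "(relu_perm m *\<^sub>v z) $ i = (\<Sum>j<2 * m. relu_perm m $$ (i, j) * z $ j)"
    by (rule mult_mat_vec_nth[OF relu_perm_carrier z i])
  also have "\<dots> = (\<Sum>j<2 * m. if j = ?k then z $ j else 0)"
    by (rule sum.cong[OF refl]) (use i in \<open>simp add: relu_perm_def\<close>)
  also have "\<dots> = z $ ?k" using k by (subst sum.delta) (auto simp del: if_split)
  finally show "(relu_perm m *\<^sub>v z) $ i = (vec m (\<lambda>i. z $ (2 * i)) @\<^sub>v vec m (\<lambda>i. z $ (2 * i + 1))) $ i"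
    using i by (auto split: if_splits)
qed (simp add: relu_perm_def)

context
  fixes G :: "real \<Rightarrow> real \<Rightarrow> hz" and I :: boxes and u :: "nat \<Rightarrow> relu_unit" and m :: nat
  assumes G: "relu_graph_family G" and I: "\<And>i. i < m \<Longrightarrow> fst (I (u i)) \<le> snd (I (u i))"
begin

lemma relaxed_relu_box_wf: "hz_wf (2 * m) (relaxed_relu_box G I lab u m)"
proof -
  let ?Zs = "map (\<lambda>i. relaxed_relu G (I (u i)) (lab (u i))) [0..<m]"
  have "hz_wf (2 * length ?Zs) (foldr hz_cart ?Zs hz_unit)"
    by (rule hz_carts_wf) (use hz_relaxed_relu_wf[OF G I] in auto)
  then show ?thesis by (simp add: relaxed_relu_box_def)
qed

lemma hz_set_relaxed_relu_box:
  "z \<in> hz_set (relaxed_relu_box G I lab u m) \<longleftrightarrow> z \<in> carrier_vec (2 * m) \<and>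
    (\<forall>i<m. (z $ (2 * i), z $ (2 * i + 1)) \<in> hz_set2 (relaxed_relu G (I (u i)) (lab (u i))))"
proof -
  let ?Zs = "map (\<lambda>i. relaxed_relu G (I (u i)) (lab (u i))) [0..<m]"
  have "z \<in> hz_set (foldr hz_cart ?Zs hz_unit) \<longleftrightarrow>
    z \<in> carrier_vec (2 * length ?Zs) \<and> (\<forall>i<length ?Zs. (z $ (2 * i), z $ (2 * i + 1)) \<in> hz_set2 (?Zs ! i))"
    by (rule hz_set_carts) (use hz_relaxed_relu_wf[OF G I] in auto)
  then show ?thesis by (simp add: relaxed_relu_box_def)
qed

lemma relu_perm_box_wf: "hz_wf (2 * m) (hz_linear (relu_perm m) (relaxed_relu_box G I lab u m))"
  by (rule hz_linear_wf[OF relaxed_relu_box_wf relu_perm_carrier])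

lemma hz_set_relu_perm_box:
  "hz_set (hz_linear (relu_perm m) (relaxed_relu_box G I lab u m)) = {s @\<^sub>v y | s y.
    s \<in> carrier_vec m \<and> y \<in> carrier_vec m \<and>
    (\<forall>i<m. (s $ i, y $ i) \<in> hz_set2 (relaxed_relu G (I (u i)) (lab (u i))))}" (is "_ = ?S")
proof (intro equalityI subsetI)
  fix w assume "w \<in> hz_set (hz_linear (relu_perm m) (relaxed_relu_box G I lab u m))"
  then obtain z where z: "w = relu_perm m *\<^sub>v z" "z \<in> hz_set (relaxed_relu_box G I lab u m)"
    unfolding hz_set_linear[OF relaxed_relu_box_wf relu_perm_carrier] by auto
  then show "w \<in> ?S"
    unfolding hz_set_relaxed_relu_box
    by (intro CollectI exI[of _ "vec m (\<lambda>i. z $ (2 * i))"] exI[of _ "vec m (\<lambda>i. z $ (2 * i + 1))"])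
      (simp add: relu_perm_mult_vec)
next
  fix w assume "w \<in> ?S"
  then obtain s y where w: "w = s @\<^sub>v y" "s \<in> carrier_vec m" "y \<in> carrier_vec m"
    "\<forall>i<m. (s $ i, y $ i) \<in> hz_set2 (relaxed_relu G (I (u i)) (lab (u i)))" by blast
  \<comment> \<open>Interleaving inverts the permutation.\<close>
  define z where "z = vec (2 * m) (\<lambda>k. if even k then s $ (k div 2) else y $ (k div 2))"
  have e: "z $ (2 * i) = s $ i" "z $ (2 * i + 1) = y $ i" if "i < m" for i
    using that by (auto simp: z_def)
  have c: "z \<in> carrier_vec (2 * m)" by (simp add: z_def)
  then have "z \<in> hz_set (relaxed_relu_box G I lab u m)"
    unfolding hz_set_relaxed_relu_box using w(4) e by auto
  moreover have "vec m (\<lambda>i. z $ (2 * i)) = s" "vec m (\<lambda>i. z $ (2 * i + 1)) = y"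
    using w(2,3) e by auto
  then have "w = relu_perm m *\<^sub>v z"
    by (simp only: relu_perm_mult_vec[OF c] w(1))
  ultimately show "w \<in> hz_set (hz_linear (relu_perm m) (relaxed_relu_box G I lab u m))"
    unfolding hz_set_linear[OF relaxed_relu_box_wf relu_perm_carrier] by blast
qed

lemma relu_image_wf: "hz_wf m Z \<Longrightarrow> hz_wf m (relu_image G I lab u m Z)"
  unfolding relu_image_def
  by (rule hz_linear_wf[OF hz_inter_wf[OF relu_perm_box_wf _ fst_proj_carrier] snd_proj_carrier])

text \<open>The same \<open>f\<close> and \<open>g\<close> serve \<open>Z\<close> and its image,
  since the image only appends the factors of the unit graphs. The coupling constraint equates the
  input half of the graph point with the value of \<open>Z\<close>; the final projection returns its
  output half.\<close>

lemma relu_imageD: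
  assumes Z: "hz_wf m Z" and feas: "hz_feasible (relu_image G I lab u m Z) f g"
  shows "hz_feasible Z f g"
    and "i < m \<Longrightarrow> (hz_eval Z f g $ i, hz_eval (relu_image G I lab u m Z) f g $ i)
      \<in> hz_set2 (relaxed_relu G (I (u i)) (lab (u i)))"
proof -
  let ?B = "hz_linear (relu_perm m) (relaxed_relu_box G I lab u m)"
  let ?f = "shift (dim_col (Gc Z)) f" and ?g = "shift (dim_col (Gb Z)) g"
  note wf = hz_inter_wf[OF relu_perm_box_wf Z fst_proj_carrier]
  have *: "hz_feasible Z f g" "hz_feasible ?B ?f ?g" "fst_proj m *\<^sub>v hz_eval ?B ?f ?g = hz_eval Z f g"
    using feas unfolding relu_image_def hz_linear_feasible[of "snd_proj m"]
      hz_inter_feasible[OF relu_perm_box_wf Z fst_proj_carrier] by auto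
  show "hz_feasible Z f g" by (rule *(1))
  have ev: "hz_eval (relu_image G I lab u m Z) f g = snd_proj m *\<^sub>v hz_eval ?B ?f ?g"
    unfolding relu_image_def hz_linear_eval[OF wf snd_proj_carrier] hz_inter_eval[OF relu_perm_box_wf] ..
  have "hz_eval ?B ?f ?g \<in> hz_set ?B" using *(2) unfolding hz_set_eq_eval by blast
  then obtain s y where "hz_eval ?B ?f ?g = s @\<^sub>v y" "s \<in> carrier_vec m" "y \<in> carrier_vec m"
    "\<forall>i<m. (s $ i, y $ i) \<in> hz_set2 (relaxed_relu G (I (u i)) (lab (u i)))"
    unfolding hz_set_relu_perm_box by blast
  then show "(hz_eval Z f g $ i, hz_eval (relu_image G I lab u m Z) f g $ i)
      \<in> hz_set2 (relaxed_relu G (I (u i)) (lab (u i)))" if "i < m"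
    using *(3) that by (simp add: ev fst_proj_append snd_proj_append)
qed

text \<open>Any output allowed by the unit graphs is reached by choosing the appended factors only.
  The old factors stay, so the values of all earlier sets survive the extension.\<close>

lemma relu_imageE:
  assumes Z: "hz_wf m Z" and feas: "hz_feasible Z f g" and y: "y \<in> carrier_vec m"
    and graph: "\<And>i. i < m \<Longrightarrow>
      (hz_eval Z f g $ i, y $ i) \<in> hz_set2 (relaxed_relu G (I (u i)) (lab (u i)))"
  obtains f' g' where "\<And>i. i < dim_col (Gc Z) \<Longrightarrow> f' i = f i" "\<And>i. i < dim_col (Gb Z) \<Longrightarrow> g' i = g i"
    "hz_feasible (relu_image G I lab u m Z) f' g'" "hz_eval (relu_image G I lab u m Z) f' g' = y"
proof -
  let ?B = "hz_linear (relu_perm m) (relaxed_relu_box G I lab u m)"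
  note wf = hz_inter_wf[OF relu_perm_box_wf Z fst_proj_carrier]
  have s: "hz_eval Z f g \<in> carrier_vec m" by (rule hz_eval_carrier[OF Z])
  have "hz_eval Z f g @\<^sub>v y \<in> hz_set ?B"
    unfolding hz_set_relu_perm_box using s y graph by blast
  then obtain a b where ab: "hz_feasible ?B a b" "hz_eval ?B a b = hz_eval Z f g @\<^sub>v y"
    unfolding hz_set_eq_eval by auto
  let ?f = "concat_at (dim_col (Gc Z)) f a" and ?g = "concat_at (dim_col (Gb Z)) g b"
  have Z': "hz_eval Z ?f ?g = hz_eval Z f g" "hz_feasible Z ?f ?g"
    using hz_feasible_cong[of Z f ?f g ?g] feas by (auto intro!: hz_eval_cong)
  have "hz_feasible (relu_image G I lab u m Z) ?f ?g"
    unfolding relu_image_def hz_linear_feasible[of "snd_proj m"]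
      hz_inter_feasible[OF relu_perm_box_wf Z fst_proj_carrier]
    using ab Z' s y by (simp add: fst_proj_append)
  moreover have "hz_eval (relu_image G I lab u m Z) ?f ?g = y"
    unfolding relu_image_def hz_linear_eval[OF wf snd_proj_carrier] hz_inter_eval[OF relu_perm_box_wf]
    using ab s y by (simp add: snd_proj_append)
  ultimately show thesis using that[of ?f ?g] by simp
qed

end

lemma relu_image_dims_le:
  "dim_col (Gc Z) \<le> dim_col (Gc (relu_image G I lab u m Z))"
  "dim_col (Gb Z) \<le> dim_col (Gb (relu_image G I lab u m Z))"
  by (simp_all add: relu_image_def)

section \<open>Relaxed runs of the network\<close>

text \<open>A relaxed unit represents the convex hull of its graph, every other unit the graph
  itself.\<close>

lemma relu_graph_subset_relaxed:
  assumes "relu_graph_family G" "fst ab \<le> snd ab"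
  shows "relu_graph (fst ab) (snd ab) \<subseteq> hz_set2 (relaxed_relu G ab lab)"
  using assms hull_subset[of "relu_graph (fst ab) (snd ab)" convex]
  by (simp add: relaxed_relu_def relu_graph_family_def)

lemma relaxed_relu_exact:
  assumes "relu_graph_family G" "fst ab \<le> snd ab" "fst ab < 0 \<and> 0 < snd ab \<Longrightarrow> lab \<noteq> 1"
  shows "hz_set2 (relaxed_relu G ab lab) = relu_graph (fst ab) (snd ab)"
  using assms by (auto simp: relaxed_relu_def relu_graph_family_def)

text \<open>If \<open>lab'\<close> is 1, then so is \<open>lab\<close> and the two sets coincide;
  otherwise the left set is the exact graph, which lies in the set of any label.\<close>

lemma relaxed_relu_mono:
  assumes "relu_graph_family G" "fst ab \<le> snd ab" "lab' = 1 \<Longrightarrow> lab = 1"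
  shows "hz_set2 (relaxed_relu G ab lab') \<subseteq> hz_set2 (relaxed_relu G ab lab)"
  using assms relu_graph_subset_relaxed[OF assms(1,2), of lab] relaxed_relu_exact[OF assms(1,2), of lab']
  by (cases "lab' = 1") simp_all

text \<open>One ranking serves all budgets, so the units labelled 1 form nested suffixes of a single
  list.\<close>

lemma label_mono: "N \<le> N' \<Longrightarrow> label us N' u = 1 \<Longrightarrow> label us N u = 1"
  using set_drop_subset_set_drop[of N N' us] by (auto simp: label_def split: if_splits)

lemma label_exact:
  assumes rank: "is_ranking \<pi> T I us" and t: "t \<le> T" and N: "num_unstable \<pi> I t + num_outranking us t \<le> N"
    and u: "u \<in> relu_units \<pi> t"
  shows "label us N u \<noteq> 1"
proof
  assume "label us N u = 1"
  then have "u \<in> set (drop N us)" by (simp add: label_def split: if_splits)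
  then obtain i where i: "i < length us - N" "u = us ! (N + i)"
    by (auto simp: in_set_conv_nth)
  define j where "j = N + i"
  have j: "N \<le> j" "j < length us" "u = us ! j" using i by (simp_all add: j_def)
  have us: "distinct us" "set us = {u \<in> relu_units \<pi> T. unstable I u}"
    using rank by (simp_all add: is_ranking_def)
  have tj: "time (us ! j) < t" using u j(3) by (auto simp: relu_units_def)
  txt \<open>
    All of the first \<open>j + 1\<close> ranked units are unstable and either belong to \<open>relu_units \<pi> t\<close> or outrank
    \<open>us ! j\<close>, which does.
  \<close>
  let ?U = "{u \<in> relu_units \<pi> t. unstable I u}"
  let ?O = "{i. i < length us \<and> t \<le> time (us ! i) \<and> (\<exists>j<length us. i < j \<and> time (us ! j) < t)}"
  let ?A = "{i. i \<le> j \<and> time (us ! i) < t}" and ?B = "{i. i \<le> j \<and> t \<le> time (us ! i)}"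
  have sub: "?U \<subseteq> set us" unfolding us(2) using t by (auto simp: relu_units_def)
  have "us ! i \<in> ?U" if "i \<in> ?A" for i
  proof -
    have "us ! i \<in> set us" using that j(2) by simp
    then show ?thesis using that unfolding us(2) by (auto simp: relu_units_def)
  qed
  then have "(!) us ` ?A \<subseteq> ?U" by blast
  moreover have "inj_on ((!) us) ?A" by (rule inj_on_nth[OF us(1)]) (use j(2) in auto)
  ultimately have A: "card ?A \<le> num_unstable \<pi> I t"
    unfolding num_unstable_def using finite_subset[OF sub] by (metis card_image card_mono List.finite_set)
  \<comment> \<open>Position \<open>j\<close> itself holds a unit of time below \<open>t\<close>, so
    members of \<open>?B\<close> lie strictly before it, and \<open>j\<close> is the later position
    that \<open>?O\<close> asks for.\<close>
  have "?B \<subseteq> ?O"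
  proof
    fix i assume i: "i \<in> ?B"
    then have "i < j" using tj by (cases "i = j") auto
    then show "i \<in> ?O" using i j(2) tj by auto
  qed
  then have B: "card ?B \<le> num_outranking us t"
    unfolding num_outranking_def by (intro card_mono) auto
  have "card ?A + card ?B = card (?A \<union> ?B)"
    by (rule card_Un_disjoint[symmetric]) auto
  \<comment> \<open>These are \<open>j + 1 > N\<close> positions, while the two counts add up to at
    most \<open>N\<close>.\<close>
  also have "?A \<union> ?B = {..j}" by auto
  finally show False using A B N j(1) by simp
qed

text \<open>Labels are left as parameters of the lemmas, so that two budgets can be compared inside
  one instance.\<close>

locale relaxation =
  fixes n T :: nat and \<pi> :: rnn and X :: hz and G :: "real \<Rightarrow> real \<Rightarrow> hz" and I :: boxes
  assumes rnn_wf: "rnn_wf n \<pi>" and X_wf: "hz_wf n X" and graph_family: "relu_graph_family G"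
    and sound: "sound_boxes \<pi> (hz_set X) T I"
begin

text \<open>
  The pairs (time, layer) are visited in lexicographic order from \<open>(1, 0)\<close> on and numbered
  \<open>0, 1, 2, \<dots>\<close>. The same layer one time step earlier is \<open>period\<close> positions back.
\<close>

abbreviation "period \<equiv> Suc (depth \<pi>)"

definition stage_time :: "nat \<Rightarrow> nat" where
  "stage_time p = Suc (p div period)"

definition stage_layer :: "nat \<Rightarrow> nat" where
  "stage_layer p = p mod period"

definition stage_width :: "nat \<Rightarrow> nat" where
  "stage_width p = width \<pi> (stage_layer p)"

text \<open>Units are attached to the transition from \<open>p\<close> to \<open>Suc p\<close> and
  hence belong to the layer after \<open>stage_layer p\<close>. After the last hidden layer this is
  the output layer, still at the same time; the time advances only with the new state.\<close>

definition stage_unit :: "nat \<Rightarrow> nat \<Rightarrow> relu_unit" where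
  "stage_unit p = (if stage_layer p = depth \<pi> then Out (stage_time p)
     else Hid (stage_time p) (Suc (stage_layer p)))"

text \<open>Stage \<open>Suc p - period\<close> is the layer about to be computed, one time step
  earlier. For \<open>p < period\<close> the time is 1 and the zero initial hidden state takes its
  place.\<close>

definition stage_preact :: "(nat \<Rightarrow> real vec) \<Rightarrow> nat \<Rightarrow> real vec" where
  "stage_preact z p = (if stage_layer p = depth \<pi> then Wy \<pi> *\<^sub>v z p + vy \<pi>
     else Wh \<pi> (Suc (stage_layer p)) *\<^sub>v
         (if p < period then 0\<^sub>v (width \<pi> (Suc (stage_layer p))) else z (Suc p - period)) +
       Wx \<pi> (Suc (stage_layer p)) *\<^sub>v z p + vh \<pi> (Suc (stage_layer p)))"

definition stage_state :: "real vec \<Rightarrow> nat \<Rightarrow> real vec" where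
  "stage_state x p = hid \<pi> x (stage_time p) (stage_layer p)"

definition stage_hz :: "(relu_unit \<Rightarrow> nat) \<Rightarrow> nat \<Rightarrow> hz" where
  "stage_hz lab p = relaxed_hid G \<pi> I lab X (stage_time p) (stage_layer p)"

definition stage_pre_hz :: "(relu_unit \<Rightarrow> nat) \<Rightarrow> nat \<Rightarrow> hz" where
  "stage_pre_hz lab p = (if stage_layer p = depth \<pi> then hz_affine (Wy \<pi>) (vy \<pi>) (stage_hz lab p)
     else if p < period then hz_affine (Wx \<pi> (Suc (stage_layer p))) (vh \<pi> (Suc (stage_layer p))) (stage_hz lab p)
     else hz_affine (append_cols (Wh \<pi> (Suc (stage_layer p))) (Wx \<pi> (Suc (stage_layer p))))
       (vh \<pi> (Suc (stage_layer p))) (hz_cprod (stage_hz lab (Suc p - period)) (stage_hz lab p)))"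

text \<open>The stage of time \<open>T\<close> and layer \<open>0\<close> when \<open>T\<close> is
  positive, by \<open>stage_mult\<close>.\<close>

definition horizon :: nat where
  "horizon = (T - 1) * period"

definition unit_graph :: "(relu_unit \<Rightarrow> nat) \<Rightarrow> nat \<Rightarrow> nat \<Rightarrow> (real \<times> real) set" where
  "unit_graph lab p i = hz_set2 (relaxed_relu G (I (stage_unit p i)) (lab (stage_unit p i)))"

text \<open>Pre-activations are computed from the run's own earlier states, so a relaxed output
  propagates into everything that follows it.\<close>

definition relaxed_run :: "(relu_unit \<Rightarrow> nat) \<Rightarrow> nat \<Rightarrow> (nat \<Rightarrow> real vec) \<Rightarrow> bool" where
  "relaxed_run lab k z \<longleftrightarrow> z 0 \<in> hz_set X \<and> (\<forall>p<k. z (Suc p) \<in> carrier_vec (stage_width (Suc p)) \<and>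
     (\<forall>i<stage_width (Suc p). (stage_preact z p $ i, z (Suc p) $ i) \<in> unit_graph lab p i))"

section \<open>The network and the algorithm as recursions over stages\<close>

lemma stage_layer_le: "stage_layer p \<le> depth \<pi>"
  using mod_less_divisor[of period p] by (simp add: stage_layer_def less_Suc_eq_le)

lemma stage_0 [simp]: "stage_time 0 = Suc 0" "stage_layer 0 = 0"
  by (simp_all add: stage_time_def stage_layer_def)

lemma stage_Suc:
  "stage_layer (Suc p) = (if stage_layer p = depth \<pi> then 0 else Suc (stage_layer p))"
  "stage_time (Suc p) = (if stage_layer p = depth \<pi> then Suc (stage_time p) else stage_time p)"
  by (auto simp: stage_layer_def stage_time_def mod_Suc div_Suc)

lemma stage_minus_period:
  assumes "period \<le> p"
  shows "stage_layer (p - period) = stage_layer p" "Suc (stage_time (p - period)) = stage_time p"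
  using assms le_mod_geq[of period p] le_div_geq[of period p]
  by (simp_all add: stage_layer_def stage_time_def)

lemma stage_mult: "stage_time (k * period) = Suc k" "stage_layer (k * period) = 0"
  unfolding stage_time_def stage_layer_def by (simp_all del: mult_Suc_right)

lemma stage_time_eq_1_iff: "stage_time p = Suc 0 \<longleftrightarrow> p < period"
  by (auto simp: stage_time_def div_eq_0_iff)

text \<open>A transition looks at two earlier stages only, so agreement on an initial segment of
  stages is enough in the inductions.\<close>

lemma stage_preact_cong:
  "z p = z' p \<Longrightarrow> (period \<le> p \<Longrightarrow> z (Suc p - period) = z' (Suc p - period)) \<Longrightarrow>
    stage_preact z p = stage_preact z' p"
  by (simp add: stage_preact_def)

text \<open>In the first period the preceding time is 0, where \<open>hid\<close> is the zero state.
  Later the wanted layer is that of stage \<open>Suc p\<close>, one period earlier.\<close>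

lemma hid_previous:
  assumes "stage_layer p \<noteq> depth \<pi>"
  shows "hid \<pi> x (stage_time p - 1) (Suc (stage_layer p)) =
    (if p < period then 0\<^sub>v (width \<pi> (Suc (stage_layer p))) else stage_state x (Suc p - period))"
proof (cases "p < period")
  case True
  then show ?thesis using stage_time_eq_1_iff[of p] by simp
next
  case False
  then have "stage_layer (Suc p - period) = Suc (stage_layer p)"
    "Suc (stage_time (Suc p - period)) = stage_time p"
    using stage_minus_period[of "Suc p"] assms by (simp_all add: stage_Suc)
  then show ?thesis using False by (simp add: stage_state_def flip: \<open>Suc (stage_time (Suc p - period)) = stage_time p\<close>)
qed

lemma stage_state_0 [simp]: "stage_state x 0 = x"
  by (simp add: stage_state_def)

text \<open>The nested recursion of \<open>hid\<close> over time and layer becomes a recursion over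
  one index, of the same shape as a relaxed run.\<close>

lemma stage_state_Suc: "stage_state x (Suc p) = relu_vec (stage_preact (stage_state x) p)"
proof (cases "stage_layer p = depth \<pi>")
  case True
  obtain s where "stage_time p = Suc s" by (simp add: stage_time_def)
  with True show ?thesis by (simp add: stage_state_def stage_Suc stage_preact_def)
next
  case False
  have "hid \<pi> x (stage_time p) (Suc (stage_layer p)) =
    relu_vec (Wh \<pi> (Suc (stage_layer p)) *\<^sub>v hid \<pi> x (stage_time p - 1) (Suc (stage_layer p)) +
      Wx \<pi> (Suc (stage_layer p)) *\<^sub>v hid \<pi> x (stage_time p) (stage_layer p) + vh \<pi> (Suc (stage_layer p)))"
    by (simp add: stage_time_def)
  then show ?thesis using False
    unfolding hid_previous[OF False] by (simp add: stage_state_def[of x "Suc p"] stage_state_def[of x p] stage_Suc stage_preact_def)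
qed

lemma preact_stage_unit: "preact \<pi> x (stage_unit p i) = stage_preact (stage_state x) p $ i"
proof (cases "stage_layer p = depth \<pi>")
  case False
  then show ?thesis
    using hid_previous[OF False, of x] by (simp add: stage_unit_def stage_preact_def stage_state_def[of x p])
qed (simp add: stage_unit_def stage_preact_def stage_state_def)

lemma weights_carrier:
  assumes "l < depth \<pi>"
  shows "Wh \<pi> (Suc l) \<in> carrier_mat (width \<pi> (Suc l)) (width \<pi> (Suc l))"
    "Wx \<pi> (Suc l) \<in> carrier_mat (width \<pi> (Suc l)) (width \<pi> l)" "vh \<pi> (Suc l) \<in> carrier_vec (width \<pi> (Suc l))"
proof -
  have "Suc l \<in> {1..depth \<pi>}" using assms by simp
  then have "Wh \<pi> (Suc l) \<in> carrier_mat (width \<pi> (Suc l)) (width \<pi> (Suc l)) \<and>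
        Wx \<pi> (Suc l) \<in> carrier_mat (width \<pi> (Suc l)) (width \<pi> (Suc l - 1)) \<and>
        vh \<pi> (Suc l) \<in> carrier_vec (width \<pi> (Suc l))"
    using rnn_wf unfolding rnn_wf_def by blast
  then show "Wh \<pi> (Suc l) \<in> carrier_mat (width \<pi> (Suc l)) (width \<pi> (Suc l))"
    "Wx \<pi> (Suc l) \<in> carrier_mat (width \<pi> (Suc l)) (width \<pi> l)" "vh \<pi> (Suc l) \<in> carrier_vec (width \<pi> (Suc l))"
    by simp_all
qed

lemma output_carrier: "Wy \<pi> \<in> carrier_mat (width \<pi> 0) (width \<pi> (depth \<pi>))" "vy \<pi> \<in> carrier_vec (width \<pi> 0)"
  and width_0: "width \<pi> 0 = n"
  using rnn_wf by (simp_all add: rnn_wf_def)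

lemma stage_layer_less: "stage_layer p \<noteq> depth \<pi> \<Longrightarrow> stage_layer p < depth \<pi>"
  using stage_layer_le[of p] by simp

text \<open>A sum of vectors has the dimension of its last summand, here the bias, whatever the
  states \<open>z\<close> are.\<close>

lemma stage_preact_carrier:
  "stage_preact z p \<in> carrier_vec (stage_width (Suc p))"
  using carrier_vecD[OF output_carrier(2)] carrier_vecD[OF weights_carrier(3)[OF stage_layer_less[of p]]]
  by (intro carrier_vecI) (simp add: stage_preact_def stage_width_def stage_Suc)

lemma stage_hz_0 [simp]: "stage_hz lab 0 = X"
  by (simp add: stage_hz_def)

text \<open>The cases output layer, hidden layer at time 1 and hidden layer at a later time match
  the equations of \<open>relaxed_hid\<close> that compute a new set.\<close>

lemma stage_hz_Suc:
  "stage_hz lab (Suc p) = relu_image G I lab (stage_unit p) (stage_width (Suc p)) (stage_pre_hz lab p)"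
proof (cases "stage_layer p = depth \<pi>")
  case True
  obtain s where "stage_time p = Suc s" by (simp add: stage_time_def)
  with True show ?thesis
    by (simp add: stage_hz_def stage_pre_hz_def stage_unit_def stage_width_def stage_Suc)
next
  case False
  show ?thesis
  proof (cases "p < period")
    case True
    then have "stage_time p = Suc 0" by (simp add: stage_time_eq_1_iff)
    with True False show ?thesis
      by (simp add: stage_hz_def stage_pre_hz_def stage_unit_def stage_width_def stage_Suc)
  next
    case ge: False
    then have "stage_layer (Suc p - period) = Suc (stage_layer p)"
      "Suc (stage_time (Suc p - period)) = stage_time p"
      using stage_minus_period[of "Suc p"] False by (simp_all add: stage_Suc)
    moreover obtain s where "stage_time (Suc p - period) = Suc s" by (simp add: stage_time_def)
    ultimately have "stage_time p = Suc (Suc s)" "stage_hz lab (Suc p - period) = relaxed_hid G \<pi> I lab X (Suc s) (Suc (stage_layer p))"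
      by (simp_all add: stage_hz_def)
    with ge False show ?thesis
      by (simp add: stage_hz_def[of lab p] stage_hz_def[of lab "Suc p"] stage_pre_hz_def stage_unit_def stage_width_def stage_Suc)
  qed
qed

lemma stage_hz_dims_le_Suc:
  "dim_col (Gc (stage_hz lab p)) \<le> dim_col (Gc (stage_hz lab (Suc p)))"
  "dim_col (Gb (stage_hz lab p)) \<le> dim_col (Gb (stage_hz lab (Suc p)))"
proof -
  \<comment> \<open>In the product case truncated subtraction makes the width the maximum of both
    widths, so the bound is available before the two are known to be ordered.\<close>
  have "dim_col (Gc (stage_hz lab p)) \<le> dim_col (Gc (stage_pre_hz lab p))"
    "dim_col (Gb (stage_hz lab p)) \<le> dim_col (Gb (stage_pre_hz lab p))"
    by (auto simp: stage_pre_hz_def hz_cprod_def)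
  then show "dim_col (Gc (stage_hz lab p)) \<le> dim_col (Gc (stage_hz lab (Suc p)))"
    "dim_col (Gb (stage_hz lab p)) \<le> dim_col (Gb (stage_hz lab (Suc p)))"
    unfolding stage_hz_Suc using relu_image_dims_le order_trans by blast+
qed

lemma stage_hz_dims_le:
  assumes "p \<le> p'"
  shows "dim_col (Gc (stage_hz lab p)) \<le> dim_col (Gc (stage_hz lab p'))"
    "dim_col (Gb (stage_hz lab p)) \<le> dim_col (Gb (stage_hz lab p'))"
  using lift_Suc_mono_le[of "\<lambda>p. dim_col (Gc (stage_hz lab p))", OF _ assms]
    lift_Suc_mono_le[of "\<lambda>p. dim_col (Gb (stage_hz lab p))", OF _ assms] stage_hz_dims_le_Suc by blast+

text \<open>Since \<open>Suc p - period \<le> p\<close>, monotonicity of the widths turns that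
  maximum into the width of the current stage: weights add no factors.\<close>

lemma stage_pre_hz_dims:
  "dim_col (Gc (stage_pre_hz lab p)) = dim_col (Gc (stage_hz lab p))"
  "dim_col (Gb (stage_pre_hz lab p)) = dim_col (Gb (stage_hz lab p))"
  using stage_hz_dims_le[of "Suc p - period" p lab] by (auto simp: stage_pre_hz_def hz_cprod_dims)

lemma stage_pre_hz_feasible: "hz_feasible (stage_pre_hz lab p) f g \<longleftrightarrow> hz_feasible (stage_hz lab p) f g"
  using stage_hz_dims_le[of "Suc p - period" p lab]
  by (auto simp: stage_pre_hz_def hz_affine_feasible hz_cprod_feasible)

lemma stage_unit_mem:
  assumes "p < k * period" "i < stage_width (Suc p)"
  shows "stage_unit p i \<in> relu_units \<pi> (Suc k)"
proof -
  have "p div period < k" using assms(1) by (rule less_mult_imp_div_less)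
  then show ?thesis using assms(2) stage_layer_less[of p]
    by (auto simp: stage_unit_def relu_units_def stage_width_def stage_Suc stage_time_def)
qed

lemma stage_unit_mem_horizon:
  assumes "p < horizon" "i < stage_width (Suc p)"
  shows "stage_unit p i \<in> relu_units \<pi> T"
proof -
  have p: "p < (T - 1) * period" using assms(1) by (simp only: horizon_def)
  then have "Suc (T - 1) = T" by (cases T) auto
  then show ?thesis using stage_unit_mem[OF p assms(2)] by (simp only:)
qed

lemma stage_box_le:
  "p < horizon \<Longrightarrow> i < stage_width (Suc p) \<Longrightarrow> fst (I (stage_unit p i)) \<le> snd (I (stage_unit p i))"
  using stage_unit_mem_horizon sound by (auto simp: sound_boxes_def)

text \<open>All stages up to \<open>p\<close> are assumed well-formed because the constrained
  product reaches back almost a period; \<open>stage_hz_wf\<close> supplies this by course-of-values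
  induction.\<close>

lemma stage_pre_hz_wf_eval:
  assumes wf: "\<And>q. q \<le> p \<Longrightarrow> hz_wf (stage_width q) (stage_hz lab q)"
  shows "hz_wf (stage_width (Suc p)) (stage_pre_hz lab p) \<and>
    hz_eval (stage_pre_hz lab p) f g = stage_preact (\<lambda>q. hz_eval (stage_hz lab q) f g) p"
proof (cases "stage_layer p = depth \<pi>")
  case True
  then have "hz_wf (width \<pi> (depth \<pi>)) (stage_hz lab p)" using wf[of p] by (simp add: stage_width_def)
  then show ?thesis using True
    hz_affine_wf[OF _ output_carrier] hz_affine_eval[OF _ output_carrier]
    by (simp add: stage_pre_hz_def stage_preact_def stage_width_def stage_Suc)
next
  case False
  let ?l = "stage_layer p"
  note w = weights_carrier[OF stage_layer_less[OF False]]
  have p: "hz_wf (width \<pi> ?l) (stage_hz lab p)" using wf[of p] by (simp add: stage_width_def)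
  show ?thesis
  proof (cases "p < period")
    case True
    \<comment> \<open>At time 1 the algorithm omits the recurrent term, which in
      \<open>stage_preact\<close> is this vanishing product.\<close>
    have "Wh \<pi> (Suc ?l) *\<^sub>v 0\<^sub>v (width \<pi> (Suc ?l)) = 0\<^sub>v (width \<pi> (Suc ?l))"
      using w(1) by (intro eq_vecI) auto
    then show ?thesis using True False hz_affine_wf[OF p w(2,3)] hz_affine_eval[OF p w(2,3)]
      mult_mat_vec_carrier[OF w(2) hz_eval_carrier[OF p]]
      by (simp add: stage_pre_hz_def stage_preact_def stage_width_def stage_Suc)
  next
    case ge: False
    let ?q = "Suc p - period"
    have "stage_layer ?q = Suc ?l" using stage_minus_period(1)[of "Suc p"] ge False by (simp add: stage_Suc)
    then have q: "hz_wf (width \<pi> (Suc ?l)) (stage_hz lab ?q)"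
      using wf[of ?q] by (simp add: stage_width_def)
    have "?q \<le> p" by simp
    note le = stage_hz_dims_le[OF this, of lab]
    note cw = hz_cprod_wf[OF q p le] and ce = hz_cprod_eval[OF q p le]
    note aw = append_cols_carrier[OF w(1,2)]
    show ?thesis using ge False hz_affine_wf[OF cw aw w(3)] hz_affine_eval[OF cw aw w(3)] ce
      append_cols_mult_vec[OF w(1,2) hz_eval_carrier[OF q] hz_eval_carrier[OF p]]
      by (simp add: stage_pre_hz_def stage_preact_def stage_width_def stage_Suc)
  qed
qed

lemma stage_hz_wf: "p \<le> horizon \<Longrightarrow> hz_wf (stage_width p) (stage_hz lab p)"
proof (induction p rule: less_induct)
  case (less p)
  show ?case
  proof (cases p)
    case 0
    then show ?thesis using X_wf width_0 by (simp add: stage_width_def)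
  next
    case (Suc r)
    have "hz_wf (stage_width (Suc r)) (stage_pre_hz lab r)"
      by (rule stage_pre_hz_wf_eval[THEN conjunct1]) (use less Suc in auto)
    then show ?thesis unfolding Suc stage_hz_Suc
      by (intro relu_image_wf[OF graph_family] stage_box_le) (use less Suc in auto)
  qed
qed

lemma stage_pre_hz_wf: "p < horizon \<Longrightarrow> hz_wf (stage_width (Suc p)) (stage_pre_hz lab p)"
  by (rule stage_pre_hz_wf_eval[THEN conjunct1]) (auto intro: stage_hz_wf)

lemma stage_pre_hz_eval:
  "p < horizon \<Longrightarrow> hz_eval (stage_pre_hz lab p) f g = stage_preact (\<lambda>q. hz_eval (stage_hz lab q) f g) p"
  by (rule stage_pre_hz_wf_eval[THEN conjunct2]) (auto intro: stage_hz_wf)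

section \<open>Relaxed runs and feasible factors determine each other\<close>

lemma feasible_imp_relaxed_run:
  "k \<le> horizon \<Longrightarrow> hz_feasible (stage_hz lab k) f g \<Longrightarrow>
    relaxed_run lab k (\<lambda>p. hz_eval (stage_hz lab p) f g)"
proof (induction k)
  case 0
  then show ?case by (auto simp: relaxed_run_def hz_set_eq_eval)
next
  case (Suc k)
  then have k: "k < horizon" by simp
  have img: "hz_feasible (relu_image G I lab (stage_unit k) (stage_width (Suc k)) (stage_pre_hz lab k)) f g"
    using Suc.prems by (simp add: stage_hz_Suc)
  note D = relu_imageD[OF graph_family stage_box_le[OF k] stage_pre_hz_wf[OF k] img]
  \<comment> \<open>Feasibility descends with unchanged factors, so one pair of sequences produces
    the entire run.\<close>
  have "hz_feasible (stage_hz lab k) f g" using D(1) by (simp add: stage_pre_hz_feasible)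
  then have "relaxed_run lab k (\<lambda>p. hz_eval (stage_hz lab p) f g)" using Suc k by simp
  moreover have "hz_eval (stage_hz lab (Suc k)) f g \<in> carrier_vec (stage_width (Suc k))"
    using Suc.prems by (intro hz_eval_carrier stage_hz_wf)
  moreover have "(stage_preact (\<lambda>p. hz_eval (stage_hz lab p) f g) k $ i, hz_eval (stage_hz lab (Suc k)) f g $ i)
      \<in> unit_graph lab k i" if "i < stage_width (Suc k)" for i
    using D(2)[OF _ that] by (simp add: unit_graph_def stage_hz_Suc stage_pre_hz_eval[OF k])
  ultimately show ?case by (auto simp: relaxed_run_def less_Suc_eq)
qed

text \<open>The values are prescribed at every stage up to \<open>k\<close>: the next step reads an
  earlier stage through the recurrent weights, and the pair set reads stage 0.\<close>

lemma relaxed_run_imp_feasible: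
  "k \<le> horizon \<Longrightarrow> relaxed_run lab k z \<Longrightarrow>
    \<exists>f g. hz_feasible (stage_hz lab k) f g \<and> (\<forall>p\<le>k. hz_eval (stage_hz lab p) f g = z p)"
proof (induction k)
  case 0
  then have "z 0 \<in> hz_set X" by (simp add: relaxed_run_def)
  then obtain f g where "hz_feasible X f g" "hz_eval X f g = z 0" unfolding hz_set_eq_eval by auto
  then show ?case by (intro exI[of _ f] exI[of _ g]) simp
next
  case (Suc k)
  then have k: "k < horizon" by simp
  have "relaxed_run lab k z" using Suc.prems by (simp add: relaxed_run_def)
  then obtain f g where fg: "hz_feasible (stage_hz lab k) f g" "\<And>p. p \<le> k \<Longrightarrow> hz_eval (stage_hz lab p) f g = z p"
    using Suc.IH k by auto
  have pre: "hz_eval (stage_pre_hz lab k) f g = stage_preact z k"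
    unfolding stage_pre_hz_eval[OF k] by (rule stage_preact_cong) (auto simp: fg(2))
  have z: "z (Suc k) \<in> carrier_vec (stage_width (Suc k))"
    "\<And>i. i < stage_width (Suc k) \<Longrightarrow> (hz_eval (stage_pre_hz lab k) f g $ i, z (Suc k) $ i)
      \<in> hz_set2 (relaxed_relu G (I (stage_unit k i)) (lab (stage_unit k i)))"
    using Suc.prems(2) unfolding pre by (auto simp: relaxed_run_def unit_graph_def)
  have feas: "hz_feasible (stage_pre_hz lab k) f g" using fg(1) by (simp add: stage_pre_hz_feasible)
  obtain f' g' where fg': "\<And>i. i < dim_col (Gc (stage_hz lab k)) \<Longrightarrow> f' i = f i"
    "\<And>i. i < dim_col (Gb (stage_hz lab k)) \<Longrightarrow> g' i = g i"
    "hz_feasible (stage_hz lab (Suc k)) f' g'" "hz_eval (stage_hz lab (Suc k)) f' g' = z (Suc k)"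
    unfolding stage_hz_Suc
    by (rule relu_imageE[OF graph_family stage_box_le[OF k] stage_pre_hz_wf[OF k] feas z])
      (auto simp: stage_pre_hz_dims)
  have "hz_eval (stage_hz lab p) f' g' = z p" if "p \<le> k" for p
  proof -
    \<comment> \<open>The extension changes only factors beyond those of stage \<open>k\<close>, and
      earlier stages read no more than stage \<open>k\<close> does.\<close>
    have "hz_eval (stage_hz lab p) f' g' = hz_eval (stage_hz lab p) f g"
      by (rule hz_eval_cong; rule fg'(1,2); rule less_le_trans[OF _ stage_hz_dims_le(1)[OF that]]
          less_le_trans[OF _ stage_hz_dims_le(2)[OF that]])
    then show ?thesis using fg(2)[OF that] by simp
  qed
  then show ?case using fg'(3,4) by (auto simp: le_Suc_eq)
qed

lemma relaxed_run_stage_state: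
  assumes x: "x \<in> hz_set X" and k: "k \<le> horizon"
  shows "relaxed_run lab k (stage_state x)"
  unfolding relaxed_run_def
proof (intro conjI allI impI)
  show "stage_state x 0 \<in> hz_set X" using x by simp
next
  fix p assume p: "p < k"
  show "stage_state x (Suc p) \<in> carrier_vec (stage_width (Suc p))"
    using stage_preact_carrier[of "stage_state x" p] by (simp add: stage_state_Suc relu_vec_def)
  fix i assume i: "i < stage_width (Suc p)"
  have ph: "p < horizon" using p k by simp
  have "stage_preact (stage_state x) p $ i \<in> {fst (I (stage_unit p i))..snd (I (stage_unit p i))}"
    using sound stage_unit_mem_horizon[OF ph i] x unfolding sound_boxes_def
    by (auto simp flip: preact_stage_unit)
  then have "(stage_preact (stage_state x) p $ i, stage_state x (Suc p) $ i)
      \<in> relu_graph (fst (I (stage_unit p i))) (snd (I (stage_unit p i)))"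
    using i stage_preact_carrier[of "stage_state x" p]
    by (auto simp: relu_graph_def stage_state_Suc relu_vec_def)
  then show "(stage_preact (stage_state x) p $ i, stage_state x (Suc p) $ i) \<in> unit_graph lab p i"
    using relu_graph_subset_relaxed[OF graph_family stage_box_le[OF ph i]] unfolding unit_graph_def by blast
qed

text \<open>An exact graph has one output for each input, so every transition is forced. The
  induction is course-of-values because of the recurrent look-back.\<close>

lemma relaxed_run_exact:
  assumes run: "relaxed_run lab k z" and k: "k \<le> horizon"
    and lab: "\<And>p i. p < k \<Longrightarrow> i < stage_width (Suc p) \<Longrightarrow> lab (stage_unit p i) \<noteq> 1"
  shows "p \<le> k \<Longrightarrow> z p = stage_state (z 0) p"
proof (induction p rule: less_induct)
  case (less p)
  show ?case
  proof (cases p)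
    case (Suc r)
    then have r: "r < k" "r < horizon" using less.prems k by auto
    have pre: "stage_preact z r = stage_preact (stage_state (z 0)) r"
      by (rule stage_preact_cong; rule less.IH) (use less.prems Suc in simp_all)
    have z: "z (Suc r) \<in> carrier_vec (stage_width (Suc r))"
      "\<And>i. i < stage_width (Suc r) \<Longrightarrow> (stage_preact z r $ i, z (Suc r) $ i) \<in> unit_graph lab r i"
      using run r(1) by (auto simp: relaxed_run_def)
    have "z (Suc r) = relu_vec (stage_preact z r)"
    proof (rule eq_vecI)
      show "dim_vec (z (Suc r)) = dim_vec (relu_vec (stage_preact z r))"
        using z(1) stage_preact_carrier[of z r] by (auto simp: relu_vec_def)
      fix i assume "i < dim_vec (relu_vec (stage_preact z r))"
      then have i: "i < stage_width (Suc r)" "i < dim_vec (stage_preact z r)"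
        using stage_preact_carrier[of z r] by (auto simp: relu_vec_def)
      have "unit_graph lab r i = relu_graph (fst (I (stage_unit r i))) (snd (I (stage_unit r i)))"
        unfolding unit_graph_def
        by (rule relaxed_relu_exact[OF graph_family stage_box_le[OF r(2) i(1)]]) (rule lab[OF r(1) i(1)])
      then show "z (Suc r) $ i = relu_vec (stage_preact z r) $ i"
        using z(2)[OF i(1)] i(2) by (auto simp: relu_graph_def relu_vec_def)
    qed
    then show ?thesis unfolding Suc stage_state_Suc pre .
  qed simp
qed

lemma relaxed_run_mono:
  assumes "k \<le> horizon" "\<And>u. lab' u = 1 \<Longrightarrow> lab u = 1" "relaxed_run lab' k z"
  shows "relaxed_run lab k z"
proof -
  have "unit_graph lab' p i \<subseteq> unit_graph lab p i" if "p < k" "i < stage_width (Suc p)" for p i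
    unfolding unit_graph_def
    by (rule relaxed_relu_mono[OF graph_family stage_box_le]) (use assms that in auto)
  then show ?thesis using assms(3) unfolding relaxed_run_def by blast
qed

section \<open>Reachable sets at a fixed time \<open>t\<close>, whose closed-loop state is stage
  \<open>k\<close>\<close>

context
  fixes t k :: nat
  assumes t: "t \<in> {2..T}"
  defines "k \<equiv> (t - 1) * period"
begin

lemma k_le: "k \<le> horizon"
  unfolding k_def horizon_def using t by (intro mult_le_mono1) auto

lemma stage_k: "stage_time k = t" "stage_layer k = 0"
  unfolding k_def using stage_mult[of "t - 1"] t by auto

lemma pairs_eq: "relaxed_pairs G \<pi> I us X N t = hz_cprod (stage_hz (label us N) 0) (stage_hz (label us N) k)"
  unfolding relaxed_pairs_def stage_hz_def[of _ k] stage_k by simp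

lemma stage_hz_k_wf: "hz_wf n (stage_hz lab 0)" "hz_wf n (stage_hz lab k)"
  using stage_hz_wf[of 0 lab] stage_hz_wf[OF k_le, of lab] stage_k width_0 by (simp_all add: stage_width_def)

lemma pairs_wf: "hz_wf (2 * n) (relaxed_pairs G \<pi> I us X N t)"
  unfolding pairs_eq mult_2 by (rule hz_cprod_wf[OF stage_hz_k_wf stage_hz_dims_le[OF le0]])

text \<open>Feasibility at stage \<open>k\<close> alone governs the product, and both of its
  components are values of one run; the intermediate states are projected away.\<close>

lemma hz_set_pairs:
  "hz_set (relaxed_pairs G \<pi> I us X N t) = {z 0 @\<^sub>v z k | z. relaxed_run (label us N) k z}"
proof -
  let ?H = "stage_hz (label us N)"
  have "hz_set (relaxed_pairs G \<pi> I us X N t) = {hz_eval (?H 0) f g @\<^sub>v hz_eval (?H k) f g | f g. hz_feasible (?H k) f g}"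
    unfolding pairs_eq hz_set_eq_eval hz_cprod_eval[OF stage_hz_k_wf stage_hz_dims_le[OF le0]]
      hz_cprod_feasible[OF stage_hz_dims_le[OF le0]] ..
  also have "\<dots> = {z 0 @\<^sub>v z k | z. relaxed_run (label us N) k z}"
  proof (intro equalityI subsetI)
    fix w assume "w \<in> {hz_eval (?H 0) f g @\<^sub>v hz_eval (?H k) f g | f g. hz_feasible (?H k) f g}"
    then obtain f g where fg: "w = hz_eval (?H 0) f g @\<^sub>v hz_eval (?H k) f g" "hz_feasible (?H k) f g" by blast
    show "w \<in> {z 0 @\<^sub>v z k | z. relaxed_run (label us N) k z}"
      unfolding fg(1) by (intro CollectI exI[of _ "\<lambda>p. hz_eval (?H p) f g"] conjI refl
          feasible_imp_relaxed_run[OF k_le fg(2)])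
  next
    fix w assume "w \<in> {z 0 @\<^sub>v z k | z. relaxed_run (label us N) k z}"
    then obtain z where z: "w = z 0 @\<^sub>v z k" "relaxed_run (label us N) k z" by blast
    obtain f g where "hz_feasible (?H k) f g" "\<forall>p\<le>k. hz_eval (?H p) f g = z p"
      using relaxed_run_imp_feasible[OF k_le z(2)] by blast
    then have "hz_feasible (?H k) f g \<and> w = hz_eval (?H 0) f g @\<^sub>v hz_eval (?H k) f g"
      unfolding z(1) by (metis le0 le_refl)
    then show "w \<in> {hz_eval (?H 0) f g @\<^sub>v hz_eval (?H k) f g | f g. hz_feasible (?H k) f g}"
      by blast
  qed
  finally show ?thesis .
qed

lemma relaxed_run_carrier:
  assumes "relaxed_run lab k z"
  shows "z 0 \<in> carrier_vec n" "z k \<in> carrier_vec n"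
proof -
  show "z 0 \<in> carrier_vec n" using assms hz_set_carrier[OF X_wf] by (auto simp: relaxed_run_def)
  obtain f g where "hz_eval (stage_hz lab k) f g = z k"
    using relaxed_run_imp_feasible[OF k_le assms] by blast
  then show "z k \<in> carrier_vec n" using hz_eval_carrier[OF stage_hz_k_wf(2)] by metis
qed

lemma hz_set_relaxed_fwd:
  assumes "hz_wf n Y"
  shows "hz_set (relaxed_fwd n (relaxed_pairs G \<pi> I us X N t) Y) =
    {z k | z. relaxed_run (label us N) k z \<and> z 0 \<in> hz_set Y}"
proof -
  have "hz_set (relaxed_fwd n (relaxed_pairs G \<pi> I us X N t) Y) =
    (\<lambda>w. snd_proj n *\<^sub>v w) ` {w \<in> hz_set (relaxed_pairs G \<pi> I us X N t). fst_proj n *\<^sub>v w \<in> hz_set Y}"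
    unfolding relaxed_fwd_def
      hz_set_linear[OF hz_inter_wf[OF pairs_wf assms fst_proj_carrier] snd_proj_carrier]
      hz_set_inter[OF pairs_wf assms fst_proj_carrier] ..
  also have "\<dots> = {snd_proj n *\<^sub>v (z 0 @\<^sub>v z k) | z. relaxed_run (label us N) k z \<and> fst_proj n *\<^sub>v (z 0 @\<^sub>v z k) \<in> hz_set Y}"
    unfolding hz_set_pairs by blast
  also have "\<dots> = {z k | z. relaxed_run (label us N) k z \<and> z 0 \<in> hz_set Y}"
    by (intro Collect_cong arg_cong[where f = Ex] ext)
      (auto simp: fst_proj_append[OF relaxed_run_carrier] snd_proj_append[OF relaxed_run_carrier])
  finally show ?thesis .
qed

lemma hz_set_relaxed_bwd:
  assumes "hz_wf n Y"
  shows "hz_set (relaxed_bwd n (relaxed_pairs G \<pi> I us X N t) Y) =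
    {z 0 | z. relaxed_run (label us N) k z \<and> z k \<in> hz_set Y}"
proof -
  have "hz_set (relaxed_bwd n (relaxed_pairs G \<pi> I us X N t) Y) =
    (\<lambda>w. fst_proj n *\<^sub>v w) ` {w \<in> hz_set (relaxed_pairs G \<pi> I us X N t). snd_proj n *\<^sub>v w \<in> hz_set Y}"
    unfolding relaxed_bwd_def
      hz_set_linear[OF hz_inter_wf[OF pairs_wf assms snd_proj_carrier] fst_proj_carrier]
      hz_set_inter[OF pairs_wf assms snd_proj_carrier] ..
  also have "\<dots> = {fst_proj n *\<^sub>v (z 0 @\<^sub>v z k) | z. relaxed_run (label us N) k z \<and> snd_proj n *\<^sub>v (z 0 @\<^sub>v z k) \<in> hz_set Y}"
    unfolding hz_set_pairs by blast
  also have "\<dots> = {z 0 | z. relaxed_run (label us N) k z \<and> z k \<in> hz_set Y}"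
    by (intro Collect_cong arg_cong[where f = Ex] ext)
      (auto simp: fst_proj_append[OF relaxed_run_carrier] snd_proj_append[OF relaxed_run_carrier])
  finally show ?thesis .
qed

lemma stage_state_k: "stage_state x k = hid \<pi> x t 0"
  by (simp add: stage_state_def stage_k)

lemma fwd_reach_subset:
  assumes "hz_wf n Y" "hz_set Y \<subseteq> hz_set X"
  shows "fwd_reach \<pi> t (hz_set Y) \<subseteq> hz_set (relaxed_fwd n (relaxed_pairs G \<pi> I us X N t) Y)"
proof
  fix y assume "y \<in> fwd_reach \<pi> t (hz_set Y)"
  then obtain x where x: "x \<in> hz_set Y" "y = stage_state x k"
    by (auto simp: fwd_reach_def stage_state_k)
  then have "relaxed_run (label us N) k (stage_state x)" "stage_state x 0 \<in> hz_set Y"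
    using assms(2) by (auto intro: relaxed_run_stage_state[OF _ k_le])
  then show "y \<in> hz_set (relaxed_fwd n (relaxed_pairs G \<pi> I us X N t) Y)"
    unfolding hz_set_relaxed_fwd[OF assms(1)] x(2) by blast
qed

lemma bwd_reach_subset:
  assumes "hz_wf n Y"
  shows "bwd_reach \<pi> (hz_set X) t (hz_set Y) \<subseteq> hz_set (relaxed_bwd n (relaxed_pairs G \<pi> I us X N t) Y)"
proof
  fix x assume "x \<in> bwd_reach \<pi> (hz_set X) t (hz_set Y)"
  then have x: "x \<in> hz_set X" "stage_state x k \<in> hz_set Y"
    by (auto simp: bwd_reach_def stage_state_k)
  then have "relaxed_run (label us N) k (stage_state x)"
    by (auto intro: relaxed_run_stage_state[OF _ k_le])
  moreover have "x = stage_state x 0" by simp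
  ultimately show "x \<in> hz_set (relaxed_bwd n (relaxed_pairs G \<pi> I us X N t) Y)"
    unfolding hz_set_relaxed_bwd[OF assms] using x(2) by blast
qed

lemma exact_run:
  assumes rank: "is_ranking \<pi> T I us" and N: "num_unstable \<pi> I t + num_outranking us t \<le> N"
    and run: "relaxed_run (label us N) k z"
  shows "z k = hid \<pi> (z 0) t 0"
proof -
  have "label us N (stage_unit p i) \<noteq> 1" if "p < k" "i < stage_width (Suc p)" for p i
  proof (rule label_exact[OF rank _ N])
    show "t \<le> T" using t by simp
    \<comment> \<open>Transitions before stage \<open>k\<close> have times up to
      \<open>t - 1\<close>, which are the times of the units evaluated for the state at
      \<open>t\<close>.\<close>
    have "stage_unit p i \<in> relu_units \<pi> (Suc (t - 1))"
      using that unfolding k_def by (rule stage_unit_mem)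
    then show "stage_unit p i \<in> relu_units \<pi> t" using t by simp
  qed
  then show ?thesis using relaxed_run_exact[OF run k_le _ le_refl] by (simp add: stage_state_k)
qed

lemma reach_exact:
  assumes "is_ranking \<pi> T I us" "num_unstable \<pi> I t + num_outranking us t \<le> N" "hz_wf n Y"
  shows "hz_set (relaxed_fwd n (relaxed_pairs G \<pi> I us X N t) Y) \<subseteq> fwd_reach \<pi> t (hz_set Y)"
    and "hz_set (relaxed_bwd n (relaxed_pairs G \<pi> I us X N t) Y) \<subseteq> bwd_reach \<pi> (hz_set X) t (hz_set Y)"
  \<comment> \<open>Unfolding \<open>relaxed_run\<close> supplies the membership of
    \<open>z 0\<close> in the domain that \<open>bwd_reach\<close> demands.\<close>
  using exact_run[OF assms(1,2)]
  by (auto simp: hz_set_relaxed_fwd[OF assms(3)] hz_set_relaxed_bwd[OF assms(3)] fwd_reach_def bwd_reach_def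
      relaxed_run_def[of _ k])

lemma reach_mono:
  assumes "N \<le> N'" "hz_wf n Y"
  shows "hz_set (relaxed_fwd n (relaxed_pairs G \<pi> I us X N' t) Y)
      \<subseteq> hz_set (relaxed_fwd n (relaxed_pairs G \<pi> I us X N t) Y)"
    and "hz_set (relaxed_bwd n (relaxed_pairs G \<pi> I us X N' t) Y)
      \<subseteq> hz_set (relaxed_bwd n (relaxed_pairs G \<pi> I us X N t) Y)"
proof -
  have "relaxed_run (label us N) k z" if "relaxed_run (label us N') k z" for z
    using label_mono[OF assms(1)] that by (rule relaxed_run_mono[OF k_le])
  then show "hz_set (relaxed_fwd n (relaxed_pairs G \<pi> I us X N' t) Y)
      \<subseteq> hz_set (relaxed_fwd n (relaxed_pairs G \<pi> I us X N t) Y)"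
    "hz_set (relaxed_bwd n (relaxed_pairs G \<pi> I us X N' t) Y)
      \<subseteq> hz_set (relaxed_bwd n (relaxed_pairs G \<pi> I us X N t) Y)"
    unfolding hz_set_relaxed_fwd[OF assms(2)] hz_set_relaxed_bwd[OF assms(2)] by blast+
qed

end

end

text \<open>At \<open>t = T\<close> the exactness threshold is \<open>num_unstable\<close> itself,
  by \<open>num_outranking_horizon\<close>; by \<open>num_unstable_outranking_le\<close> a budget of
  \<open>num_unstable \<pi> I T\<close> reaches the threshold at every \<open>t\<close>.\<close>

theorem theorem2:
  fixes n T t Nb :: nat and \<pi> :: rnn and X X1 Tgt :: hz
    and G :: "real \<Rightarrow> real \<Rightarrow> hz" and I :: boxes and us :: "relu_unit list"
  assumes "rnn_wf n \<pi>"
    and "hz_wf n X"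
    and "T > 1"
    and "relu_graph_family G"
    and "sound_boxes \<pi> (hz_set X) T I"
    and "is_ranking \<pi> T I us"
    and "t \<in> {2..T}"
    and "hz_wf n X1" and "hz_set X1 \<subseteq> hz_set X"
    and "hz_wf n Tgt" and "hz_set Tgt \<subseteq> hz_set X"
  shows
    "fwd_reach \<pi> t (hz_set X1) \<subseteq> hz_set (relaxed_fwd n (relaxed_pairs G \<pi> I us X Nb t) X1) \<and>
     bwd_reach \<pi> (hz_set X) t (hz_set Tgt) \<subseteq> hz_set (relaxed_bwd n (relaxed_pairs G \<pi> I us X Nb t) Tgt) \<and>
     (num_unstable \<pi> I t + num_outranking us t \<le> Nb \<longrightarrow>
        hz_set (relaxed_fwd n (relaxed_pairs G \<pi> I us X Nb t) X1) = fwd_reach \<pi> t (hz_set X1) \<and>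
        hz_set (relaxed_bwd n (relaxed_pairs G \<pi> I us X Nb t) Tgt) = bwd_reach \<pi> (hz_set X) t (hz_set Tgt)) \<and>
     (\<forall>Nb' \<ge> Nb.
        hz_set (relaxed_fwd n (relaxed_pairs G \<pi> I us X Nb' t) X1)
          \<subseteq> hz_set (relaxed_fwd n (relaxed_pairs G \<pi> I us X Nb t) X1) \<and>
        hz_set (relaxed_bwd n (relaxed_pairs G \<pi> I us X Nb' t) Tgt)
          \<subseteq> hz_set (relaxed_bwd n (relaxed_pairs G \<pi> I us X Nb t) Tgt))"
proof -
  interpret relaxation n T \<pi> X G I
    by unfold_locales (rule assms(1,2,4,5))+
  note fwd = fwd_reach_subset[OF assms(7,8,9), of us Nb] and bwd = bwd_reach_subset[OF assms(7,10), of us Nb]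
  show ?thesis
    using fwd bwd subset_antisym[OF reach_exact(1)[OF assms(7,6) _ assms(8)] fwd]
      subset_antisym[OF reach_exact(2)[OF assms(7,6) _ assms(10)] bwd]
      reach_mono(1)[OF assms(7) _ assms(8)] reach_mono(2)[OF assms(7) _ assms(10)]
    by blast
qed

end
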